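(* Let $n\ge2$, $\alpha\in(-n,0)$, and let $\phi$ be a Young function satisfying $\underline\Lambda_\phi(\alpha)<\infty$ and $\overline\Lambda_\phi(\alpha)<\infty$. Then a domain $\Omega\subset\mathbb R^n$ is globally $n$-regular if and only if there exists a constant $C\ge1$ such that: when $\operatorname{diam}\Omega<\infty$, $$\|u-u_\Omega\|_{L^{n/|\alpha|}(\Omega)}\le C\|u\|_{\dot{\mathbf B}^{\alpha,\phi}(\Omega)}\quad\forall u\in\dot{\mathbf B}^{\alpha,\phi}(\Omega);$$ and when $\operatorname{diam}\Omega=\infty$, $$\|u\|_{L^{n/|\alpha|}(\Omega)}\le C\|u\|_{\dot{\mathbf B}^{\alpha,\phi}(\Omega)}\quad\forall u\in\dot{\mathbf B}^{\alpha,\phi}(\Omega)\text{ having bounded support}.$$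
   Context: A Young function is $\phi\in C([0,\infty))$, convex, with $\phi(0)=0$, $\phi(t)>0$ for $t>0$ and $\lim_{t\to\infty}\phi(t)=\infty$. Define $\underline\Lambda_\phi(\alpha):=\sup_{x>0}\int_0^1\frac{\phi(t^{1-\alpha}x)}{\phi(x)}\frac{dt}{t^{n+1}}$ and $\overline\Lambda_\phi(\alpha):=\sup_{x>0}\int_1^\infty\frac{\phi(t^{-\alpha}x)}{\phi(x)}\frac{dt}{t^{n+1}}$. For a domain $\Omega$, $\dot{\mathbf B}^{\alpha,\phi}(\Omega)$ is the space of measurable $u$ on $\Omega$ with finite $\|u\|_{\dot{\mathbf B}^{\alpha,\phi}(\Omega)}:=\inf\{\lambda>0:\int_\Omega\int_\Omega\phi(\frac{|u(x)-u(y)|}{\lambda|x-y|^{\alpha}})\frac{dx\,dy}{|x-y|^{2n}}\le1\}$. $u_\Omega$ is the average of $u$ over $\Omega$. A domain $\Omega$ is globally $n$-regular if there is $\theta\in(0,1)$ with $|B(x,r)\cap\Omega|\ge\theta r^n$ for all $x\in\Omega$ and all $0<r<2\operatorname{diam}\Omega$. *)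

theory Defs
  imports "HOL-Analysis.Analysis"
begin

definition young_function :: "(real \<Rightarrow> real) \<Rightarrow> bool" where
  "young_function phi \<longleftrightarrow>
     continuous_on {0..} phi \<and> convex_on {0..} phi \<and> phi 0 = 0 \<and>
     (\<forall>t>0. phi t > 0) \<and> filterlim phi at_top at_top"

definition lower_Lambda :: "nat \<Rightarrow> (real \<Rightarrow> real) \<Rightarrow> real \<Rightarrow> ennreal" where
  "lower_Lambda n phi \<alpha> =
     (SUP x\<in>{0<..}. \<integral>\<^sup>+ t\<in>{0<..<1}.
        ennreal (phi (t powr (1 - \<alpha>) * x) / phi x / t ^ (n + 1)) \<partial>lborel)"

definition upper_Lambda :: "nat \<Rightarrow> (real \<Rightarrow> real) \<Rightarrow> real \<Rightarrow> ennreal" where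
  "upper_Lambda n phi \<alpha> =
     (SUP x\<in>{0<..}. \<integral>\<^sup>+ t\<in>{1<..}.
        ennreal (phi (t powr (- \<alpha>) * x) / phi x / t ^ (n + 1)) \<partial>lborel)"

definition is_domain :: "'a::euclidean_space set \<Rightarrow> bool" where
  "is_domain \<Omega> \<longleftrightarrow> open \<Omega> \<and> connected \<Omega> \<and> \<Omega> \<noteq> {}"

text \<open>Globally n-regular; for unbounded \<Omega> the diameter is \<infinity> so all r > 0 are allowed.\<close>
definition globally_regular :: "'a::euclidean_space set \<Rightarrow> bool" where
  "globally_regular \<Omega> \<longleftrightarrow>
     (\<exists>\<theta>. 0 < \<theta> \<and> \<theta> < 1 \<and>
        (\<forall>x\<in>\<Omega>. \<forall>r. 0 < r \<and> (bounded \<Omega> \<longrightarrow> r < 2 * diameter \<Omega>) \<longrightarrow>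
            measure lebesgue (ball x r \<inter> \<Omega>) \<ge> \<theta> * r ^ DIM('a)))"

definition besov_modular ::
  "real \<Rightarrow> (real \<Rightarrow> real) \<Rightarrow> 'a::euclidean_space set \<Rightarrow> ('a \<Rightarrow> real) \<Rightarrow> real \<Rightarrow> ennreal" where
  "besov_modular \<alpha> phi \<Omega> u lam =
     (\<integral>\<^sup>+ x\<in>\<Omega>. \<integral>\<^sup>+ y\<in>\<Omega>.
        ennreal (phi (\<bar>u x - u y\<bar> / (lam * norm (x - y) powr \<alpha>))
                 / norm (x - y) ^ (2 * DIM('a))) \<partial>lebesgue \<partial>lebesgue)"

definition besov_admissible ::
  "real \<Rightarrow> (real \<Rightarrow> real) \<Rightarrow> 'a::euclidean_space set \<Rightarrow> ('a \<Rightarrow> real) \<Rightarrow> real set" where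
  "besov_admissible \<alpha> phi \<Omega> u = {lam. lam > 0 \<and> besov_modular \<alpha> phi \<Omega> u lam \<le> 1}"

definition besov_norm ::
  "real \<Rightarrow> (real \<Rightarrow> real) \<Rightarrow> 'a::euclidean_space set \<Rightarrow> ('a \<Rightarrow> real) \<Rightarrow> real" where
  "besov_norm \<alpha> phi \<Omega> u = Inf (besov_admissible \<alpha> phi \<Omega> u)"

text \<open>Measurable functions on \<Omega> with finite Besov (Luxemburg) norm.\<close>
definition besov_space ::
  "real \<Rightarrow> (real \<Rightarrow> real) \<Rightarrow> 'a::euclidean_space set \<Rightarrow> ('a \<Rightarrow> real) set" where
  "besov_space \<alpha> phi \<Omega> =
     {u. u \<in> borel_measurable (restrict_space lebesgue \<Omega>) \<and> besov_admissible \<alpha> phi \<Omega> u \<noteq> {}}"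

definition Lp_norm :: "real \<Rightarrow> 'a::euclidean_space set \<Rightarrow> ('a \<Rightarrow> real) \<Rightarrow> ennreal" where
  "Lp_norm p \<Omega> f =
     (let I = \<integral>\<^sup>+ x\<in>\<Omega>. ennreal (\<bar>f x\<bar> powr p) \<partial>lebesgue
      in if I = \<infinity> then \<infinity> else ennreal (enn2real I powr (1 / p)))"

definition average :: "'a::euclidean_space set \<Rightarrow> ('a \<Rightarrow> real) \<Rightarrow> real" where
  "average \<Omega> u = (LINT x:\<Omega>|lebesgue. u x) / measure lebesgue \<Omega>"

end

theory Submission
  imports Defs
begin

text \<open>
  Put \<open>n = DIM('a)\<close> and \<open>q = n / \<bar>\<alpha>\<bar>\<close>. Finiteness of \<open>upper_Lambda\<close> gives
  \<open>\<phi>(s x) \<le> K s\<^sup>q \<phi>(x)\<close> for \<open>s \<ge> 1\<close>, and makes \<open>\<phi>(s) / s\<^sup>q\<close> arbitrarily small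
  for suitable large \<open>s\<close>.

  Regularity implies the embedding: let \<open>v \<ge> 0\<close> have modular at most \<open>1\<close> and be positive on at most half of
  \<open>\<Omega>\<close>, and let \<open>m k\<close> be the measure of the level set \<open>{v > 2\<^sup>k}\<close>. A point of that set sees, at
  distance comparable to the \<open>n\<close>-th root of \<open>m (k - 1)\<close>, a set of measure at least \<open>m (k - 1)\<close> on
  which \<open>v \<le> 2\<^sup>k / 2\<close>. With \<open>b k = 2\<^sup>k (m k)\<^bsup>1/q\<^esup>\<close> this bounds
  \<open>\<Sum>k. m k / m (k - 1) * \<phi>(b (k - 1))\<close>; the growth of \<open>\<phi>\<close> turns this into a bound for
  \<open>\<Sum>k. \<phi>(b k)\<close>, then for \<open>\<Sum>k. (b k)\<^sup>q\<close>, which is comparable to the integral of \<open>v\<^sup>q\<close>.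
  It is applied to \<open>\<bar>u\<bar>\<close> if \<open>\<Omega>\<close> is unbounded, and to both parts of \<open>u\<close> minus a median if it is bounded.

  The embedding implies regularity: a Lipschitz cutoff between the radii \<open>\<delta>\<close> and \<open>2 \<delta>\<close> has a modular
  controlled by \<open>lower_Lambda\<close> and \<open>upper_Lambda\<close>. If \<open>\<Omega>\<close> fills less than a small fraction
  \<open>\<epsilon>\<close> of \<open>ball x (2 \<delta>)\<close>, the embedding shows the same for \<open>ball x \<delta>\<close>, with the same \<open>\<epsilon>\<close>.
  Iterating contradicts that \<open>x\<close> is interior.
\<close>

section \<open>Young functions\<close>

lemma young_scale:
  assumes "young_function phi" "0 \<le> c" "c \<le> 1" "0 \<le> x"
  shows "phi (c * x) \<le> c * phi x"
proof -
  have "convex_on {0..} phi" "phi 0 = 0"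
    using assms(1) by (auto simp: young_function_def)
  from convex_onD[OF this(1), of c 0 x] this(2) assms show ?thesis
    by simp
qed

lemma young_nonneg:
  assumes "young_function phi" "0 \<le> x"
  shows "0 \<le> phi x"
  using assms by (cases "x = 0") (auto simp: young_function_def less_eq_real_def)

lemma young_mono:
  assumes "young_function phi" "0 \<le> x" "x \<le> y"
  shows "phi x \<le> phi y"
proof (cases "y = 0")
  case False
  with assms have y: "y > 0" by simp
  have "phi (x / y * y) \<le> x / y * phi y"
    using assms y by (intro young_scale) auto
  also have "\<dots> \<le> 1 * phi y"
    using assms y young_nonneg[of phi y] by (intro mult_right_mono) auto
  finally show ?thesis using y by simp
qed (use assms in simp)

text \<open>A Young function is constrained on \<open>{0..}\<close> only, so \<open>phi\<close>
  itself need not be measurable on the whole line. The later kernels are rewritten with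
  \<open>\<bar>t\<bar>\<close>, which changes nothing on nonnegative arguments.\<close>

lemma young_abs_measurable:
  assumes "young_function phi"
  shows "(\<lambda>t. phi \<bar>t\<bar>) \<in> borel_measurable borel"
proof -
  have "continuous_on UNIV (\<lambda>t::real. phi \<bar>t\<bar>)"
    using assms by (intro continuous_on_compose2[of "{0..}" phi UNIV abs])
      (auto simp: young_function_def intro!: continuous_intros)
  then show ?thesis by (rule borel_measurable_continuous_onI)
qed

lemma upper_Lambda_bound:
  assumes x: "x > 0"
  shows "(\<integral>\<^sup>+ t\<in>{1<..}. ennreal (phi (t powr (- \<alpha>) * x) / phi x / t ^ (n + 1)) \<partial>lborel)
    \<le> upper_Lambda n phi \<alpha>"
  unfolding upper_Lambda_def using x by (intro SUP_upper) auto

lemma lower_Lambda_bound: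
  assumes x: "x > 0"
  shows "(\<integral>\<^sup>+ t\<in>{0<..<1}. ennreal (phi (t powr (1 - \<alpha>) * x) / phi x / t ^ (n + 1)) \<partial>lborel)
    \<le> lower_Lambda n phi \<alpha>"
  unfolding lower_Lambda_def using x by (intro SUP_upper) auto

text \<open>For \<open>T = s powr (1 / (- \<alpha>))\<close> and \<open>t\<close> in
  \<open>{T<..2*T}\<close> the argument \<open>t powr (- \<alpha>) * x\<close> is at least
  \<open>s * x\<close> and the weight is at least \<open>(2 * T)\<close> to the power
  \<open>-(n + 1)\<close>. This interval of length \<open>T\<close> alone contributes a multiple of
  \<open>phi (s * x) / (phi x * T ^ n)\<close> to the integral, and \<open>T ^ n\<close> is the
  power of \<open>s\<close> in the claim.\<close>

lemma young_growth:
  assumes phi: "young_function phi" and \<alpha>: "\<alpha> < 0"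
    and up: "upper_Lambda n phi \<alpha> < \<infinity>"
  obtains K where "K \<ge> 1"
    "\<And>s x. s \<ge> 1 \<Longrightarrow> x \<ge> 0 \<Longrightarrow> phi (s * x) \<le> K * s powr (real n / (- \<alpha>)) * phi x"
proof
  define L where "L = enn2real (upper_Lambda n phi \<alpha>)"
  have L: "upper_Lambda n phi \<alpha> = ennreal L" "L \<ge> 0"
    using up by (auto simp: L_def)
  \<comment> \<open>The factor \<open>2 ^ (n + 1)\<close> is the loss from replacing
    \<open>t\<close> by \<open>2 * T\<close> in the weight.\<close>
  define K where "K = max 1 (L * 2 ^ (n + 1))"
  show "K \<ge> 1" by (simp add: K_def)
  show "phi (s * x) \<le> K * s powr (real n / (- \<alpha>)) * phi x" if s: "s \<ge> 1" and x: "x \<ge> 0" for s x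
  proof (cases "x = 0")
    case True
    then show ?thesis using phi by (simp add: young_function_def)
  next
    case False
    with x have x: "x > 0" by simp
    have phix: "phi x > 0" using phi x by (simp add: young_function_def)
    define T where "T = s powr (1 / (- \<alpha>))"
    have T1: "T \<ge> 1" unfolding T_def using s \<alpha> by (intro ge_one_powr_ge_zero) auto
    have Ta: "T powr (- \<alpha>) = s" unfolding T_def using s \<alpha> by (simp add: powr_powr)
    have Tn: "T ^ n = s powr (real n / (- \<alpha>))"
      using T1 s by (simp add: T_def powr_realpow[symmetric] powr_powr)
    define c where "c = phi (s * x) / phi x / (2 * T) ^ (n + 1)"
    have c0: "c \<ge> 0"
      using phix young_nonneg[OF phi, of "s * x"] s x T1 by (simp add: c_def)
    have "ennreal (c * T) = (\<integral>\<^sup>+ t. ennreal c * indicator {T<..2*T} t \<partial>lborel)"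
      using T1 c0 by (simp add: nn_integral_cmult_indicator ennreal_mult)
    also have "\<dots> \<le> (\<integral>\<^sup>+ t\<in>{1<..}. ennreal (phi (t powr (- \<alpha>) * x) / phi x / t ^ (n + 1)) \<partial>lborel)"
    proof (intro nn_integral_mono)
      fix t :: real
      show "ennreal c * indicator {T<..2*T} t
        \<le> ennreal (phi (t powr (- \<alpha>) * x) / phi x / t ^ (n + 1)) * indicator {1<..} t"
      proof (cases "t \<in> {T<..2*T}")
        case True
        have "s \<le> t powr (- \<alpha>)" unfolding Ta[symmetric]
          using True T1 \<alpha> by (intro powr_mono2) auto
        then have "phi (s * x) \<le> phi (t powr (- \<alpha>) * x)"
          using s x by (intro young_mono[OF phi]) auto
        moreover have "t ^ (n + 1) \<le> (2 * T) ^ (n + 1)"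
          using True T1 by (intro power_mono) auto
        ultimately have "c \<le> phi (t powr (- \<alpha>) * x) / phi x / t ^ (n + 1)"
          unfolding c_def using True T1 phix young_nonneg[OF phi, of "s * x"] s x
          by (intro frac_le divide_right_mono) auto
        then show ?thesis using True T1 by (auto intro: ennreal_leI)
      qed auto
    qed
    also have "\<dots> \<le> ennreal L" using upper_Lambda_bound[OF x] L by metis
    finally have "c * T \<le> L" using L by simp
    moreover have "c * T = phi (s * x) / phi x / (2 ^ (n + 1) * T ^ n)"
      using T1 by (simp add: c_def field_simps power_mult_distrib)
    ultimately have "phi (s * x) \<le> L * (2 ^ (n + 1) * T ^ n) * phi x"
      using phix T1 by (simp add: divide_le_eq mult_ac)
    also have "\<dots> \<le> K * T ^ n * phi x"
      unfolding mult.assoc[symmetric] using phix T1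
      by (intro mult_right_mono) (auto simp: K_def)
    finally show ?thesis by (simp add: Tn)
  qed
qed

text \<open>If the ratio stayed above \<eta> from \<open>s0\<close> on, the integrand of
  \<open>upper_Lambda\<close> at \<open>x = 1\<close> would dominate a multiple of
  \<open>1 / t\<close> near infinity, whose integral diverges logarithmically. This strengthens the
  growth bound and supplies the smallness used to prove regularity.\<close>

lemma young_small_ratio:
  assumes phi: "young_function phi" and \<alpha>: "\<alpha> < 0"
    and up: "upper_Lambda n phi \<alpha> < \<infinity>" and "\<eta> > 0" and s0: "s0 \<ge> 1"
  obtains s where "s \<ge> s0" "phi s \<le> \<eta> * s powr (real n / (- \<alpha>))"
proof (rule ccontr)
  assume "\<not> thesis"
  then have big: "phi s > \<eta> * s powr (real n / (- \<alpha>))" if "s \<ge> s0" for s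
    using that \<open>\<And>s. \<lbrakk>s0 \<le> s; phi s \<le> \<eta> * s powr (real n / - \<alpha>)\<rbrakk> \<Longrightarrow> thesis\<close>
    by (meson not_le)
  define L where "L = enn2real (upper_Lambda n phi \<alpha>)"
  have L: "upper_Lambda n phi \<alpha> = ennreal L" "L \<ge> 0"
    using up by (auto simp: L_def)
  have phi1: "phi 1 > 0" using phi by (simp add: young_function_def)
  define T where "T = s0 powr (1 / (- \<alpha>)) + 1"
  have T1: "T > 1" unfolding T_def using s0 by simp
  define c where "c = \<eta> / phi 1"
  have c: "c > 0" using phi1 \<open>\<eta> > 0\<close> by (simp add: c_def)
  \<comment> \<open>The endpoint for which the integral of \<open>c / t\<close> from
    \<open>T\<close> to \<open>X\<close> is exactly \<open>L + 1\<close>, exceeding the supremum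
    \<open>L\<close>.\<close>
  define X where "X = T * exp ((L + 1) / c)"
  have X: "X \<ge> T" unfolding X_def using T1 L c by simp
  have "ln X = ln T + (L + 1) / c"
    unfolding X_def using T1 by (simp add: ln_mult)
  moreover have "c * ((L + 1) / c) = L + 1" using c by simp
  ultimately have "c * ln X - c * ln T = L + 1" by (metis add_diff_cancel_left' distrib_left)
  then have "ennreal (L + 1) = ennreal (c * ln X - c * ln T)" by simp
  also have "\<dots> = (\<integral>\<^sup>+ t. ennreal (c / t) * indicator {T..X} t \<partial>lborel)"
  proof (rule nn_integral_FTC_Icc[symmetric])
    fix t assume "t \<in> {T..X}"
    then have t: "t > 0" using T1 by simp
    show "((\<lambda>x. c * ln x) has_real_derivative c / t) (at t)"
      using t by (auto intro!: derivative_eq_intros)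
    show "0 \<le> c / t" using t c by simp
  qed (use X in auto)
  also have "\<dots> \<le> (\<integral>\<^sup>+ t\<in>{1<..}. ennreal (phi (t powr (- \<alpha>) * 1) / phi 1 / t ^ (n + 1)) \<partial>lborel)"
  proof (intro nn_integral_mono)
    fix t :: real
    show "ennreal (c / t) * indicator {T..X} t
      \<le> ennreal (phi (t powr (- \<alpha>) * 1) / phi 1 / t ^ (n + 1)) * indicator {1<..} t"
    proof (cases "t \<in> {T..X}")
      case True
      have "s0 = (s0 powr (1 / (- \<alpha>))) powr (- \<alpha>)" using s0 \<alpha> by (simp add: powr_powr)
      also have "\<dots> \<le> t powr (- \<alpha>)"
        using True \<alpha> by (intro powr_mono2) (auto simp: T_def)
      finally have "phi (t powr (- \<alpha>)) \<ge> \<eta> * (t powr (- \<alpha>)) powr (real n / (- \<alpha>))"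
        using big by (simp add: less_imp_le)
      also have "(t powr (- \<alpha>)) powr (real n / (- \<alpha>)) = t ^ n"
        using True T1 \<alpha> by (simp add: powr_powr powr_realpow)
      finally have "\<eta> * t ^ n / phi 1 / t ^ (n + 1) \<le> phi (t powr (- \<alpha>) * 1) / phi 1 / t ^ (n + 1)"
        using phi1 True T1 by (intro divide_right_mono) auto
      moreover have "\<eta> * t ^ n / phi 1 / t ^ (n + 1) = c / t"
        using True T1 by (simp add: c_def)
      ultimately have "c / t \<le> phi (t powr (- \<alpha>) * 1) / phi 1 / t ^ (n + 1)" by simp
      then show ?thesis using True T1 by (auto intro: ennreal_leI)
    qed auto
  qed
  also have "\<dots> \<le> ennreal L" using upper_Lambda_bound[where x=1 and phi=phi and \<alpha>="\<alpha>" and n=n] L by simp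
  finally show False using L by simp
qed

section \<open>Dyadic level sets\<close>

lemma sum_powr_two_le:
  fixes F :: "int set"
  assumes "finite F" "\<And>k. k \<in> F \<Longrightarrow> k \<le> m"
  shows "(\<Sum>k\<in>F. 2 powr real_of_int k) \<le> 2 * 2 powr real_of_int m"
  using assms
proof (induction F arbitrary: m rule: finite_linorder_max_induct)
  case (insert b A)
  have "(\<Sum>k\<in>A. 2 powr real_of_int k) \<le> 2 * 2 powr real_of_int (b - 1)"
    using insert.hyps(2) by (intro insert.IH) force
  also have "\<dots> = 2 powr real_of_int b" by (simp add: powr_diff)
  finally have "(\<Sum>k\<in>insert b A. 2 powr real_of_int k) \<le> 2 * 2 powr real_of_int b"
    using insert.hyps by (subst sum.insert) auto
  also have "\<dots> \<le> 2 * 2 powr real_of_int m"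
    using insert.prems[of b] by simp
  finally show ?case .
qed simp

text \<open>A pair of values is separated by many dyadic levels, but convexity turns the resulting sum
  into a geometric series dominated by the top level.\<close>

lemma young_sum_separating_levels_le:
  fixes F :: "int set"
  assumes phi: "young_function phi" and F: "finite F" and d: "d \<ge> 0"
  shows "(\<Sum>k\<in>F. if 2 powr real_of_int k < s \<and> t \<le> 2 powr real_of_int (k - 1)
           then phi (2 powr real_of_int (k - 1) * d) / 2 else 0) \<le> phi (\<bar>s - t\<bar> * d)"
proof -
  define G where "G = {k\<in>F. 2 powr real_of_int k < s \<and> t \<le> 2 powr real_of_int (k - 1)}"
  have finG: "finite G" using F by (simp add: G_def)
  have eq: "(\<Sum>k\<in>F. if 2 powr real_of_int k < s \<and> t \<le> 2 powr real_of_int (k - 1)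
           then phi (2 powr real_of_int (k - 1) * d) / 2 else 0)
     = (\<Sum>k\<in>G. phi (2 powr real_of_int (k - 1) * d) / 2)"
    unfolding G_def by (rule sum.inter_filter[symmetric, OF F])
  show ?thesis
  proof (cases "G = {}")
    case True
    then show ?thesis unfolding eq using young_nonneg[OF phi] d by simp
  next
    case False
    define D where "D = s - t"
    \<comment> \<open>The gap between the levels \<open>k - 1\<close> and \<open>k\<close> has
      length \<open>2 powr (k - 1)\<close>, and it lies between \<open>t\<close> and
      \<open>s\<close>.\<close>
    have sep: "2 powr real_of_int (k - 1) \<le> D" if "k \<in> G" for k
      using that by (auto simp: G_def D_def powr_diff)
    define m where "m = Max G"
    have m: "m \<in> G" using False finG by (simp add: m_def)
    have D: "D > 0" using sep[OF m] powr_gt_zero[of 2 "real_of_int (m - 1)"] by linarith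
    have "(\<Sum>k\<in>G. 2 powr real_of_int (k - 1)) = (\<Sum>k\<in>(\<lambda>k. k - 1) ` G. 2 powr real_of_int k)"
      by (subst sum.reindex) (auto simp: inj_on_def)
    also have "\<dots> \<le> 2 * 2 powr real_of_int (m - 1)"
    proof (rule sum_powr_two_le)
      fix k assume "k \<in> (\<lambda>k. k - 1) ` G"
      then obtain j where "j \<in> G" "k = j - 1" by auto
      with Max_ge[OF finG, of j] show "k \<le> m - 1" by (simp add: m_def)
    qed (use finG in simp)
    also have "\<dots> \<le> 2 * D" using sep[OF m] by simp
    finally have S: "(\<Sum>k\<in>G. 2 powr real_of_int (k - 1)) \<le> 2 * D" .
    have "(\<Sum>k\<in>G. phi (2 powr real_of_int (k - 1) * d) / 2)
        \<le> (\<Sum>k\<in>G. 2 powr real_of_int (k - 1) * (phi (D * d) / D / 2))"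
    proof (intro sum_mono)
      fix k assume k: "k \<in> G"
      have "phi (2 powr real_of_int (k - 1) / D * (D * d))
          \<le> 2 powr real_of_int (k - 1) / D * phi (D * d)"
        using sep[OF k] D d by (intro young_scale[OF phi]) auto
      then show "phi (2 powr real_of_int (k - 1) * d) / 2
          \<le> 2 powr real_of_int (k - 1) * (phi (D * d) / D / 2)"
        using D by simp
    qed
    also have "\<dots> = (\<Sum>k\<in>G. 2 powr real_of_int (k - 1)) * (phi (D * d) / D / 2)"
      by (rule sum_distrib_right[symmetric])
    also have "\<dots> \<le> 2 * D * (phi (D * d) / D / 2)"
      using S D d young_nonneg[OF phi, of "D * d"] by (intro mult_right_mono) auto
    also have "\<dots> = phi (D * d)" using D by simp
    also have "\<dots> = phi (\<bar>s - t\<bar> * d)" using D by (simp add: D_def)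
    finally show ?thesis unfolding eq .
  qed
qed

section \<open>Lower bound for the modular by level sets\<close>

text \<open>A ball of radius comparable to the \<open>n\<close>-th root of the measure of
  \<open>A\<close> contains at least that much of the complement of \<open>A\<close> in \<Omega>.
  Inside the ball \<open>phi (h * s powr a)\<close> may be small for small \<open>s\<close>, but the
  growth bound limits its decay to \<open>(s / r) ^ n\<close>, which the kernel
  \<open>1 / s ^ (2 * n)\<close> more than compensates.\<close>

lemma young_integral_outside_ge:
  fixes \<Omega> A :: "'a::euclidean_space set"
  assumes phi: "young_function phi" and a: "a > 0" and K: "K \<ge> 1"
    and growth: "\<And>s x. s \<ge> 1 \<Longrightarrow> x \<ge> 0 \<Longrightarrow> phi (s * x) \<le> K * s powr (real DIM('a) / a) * phi x"
    and \<theta>: "0 < \<theta>" "\<theta> < 1"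
    and reg: "\<And>x r. x \<in> \<Omega> \<Longrightarrow> r > 0 \<Longrightarrow> ennreal (\<theta> * r ^ DIM('a)) \<le> emeasure lebesgue \<Omega>
       \<Longrightarrow> \<theta> * r ^ DIM('a) \<le> measure lebesgue (ball x r \<inter> \<Omega>)"
    and \<Omega>: "\<Omega> \<in> sets lebesgue" and A: "A \<in> sets lebesgue" "A \<subseteq> \<Omega>"
    and fin: "emeasure lebesgue A < \<infinity>" and half: "2 * emeasure lebesgue A \<le> emeasure lebesgue \<Omega>"
    and M: "measure lebesgue A > 0" and x: "x \<in> A" and h: "h \<ge> 0"
  shows "ennreal (\<theta>\<^sup>2 / (4 * K) * phi (h * measure lebesgue A powr (a / real DIM('a))) / measure lebesgue A)
    \<le> (\<integral>\<^sup>+ y\<in>\<Omega> - A. ennreal (phi (h * norm (x - y) powr a) / norm (x - y) ^ (2 * DIM('a))) \<partial>lebesgue)"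
proof -
  let ?n = "DIM('a)"
  define M where "M = measure lebesgue A"
  have M0: "M > 0" using M by (simp add: M_def)
  have eA: "emeasure lebesgue A = ennreal M"
    using fin by (simp add: M_def emeasure_eq_ennreal_measure)
  \<comment> \<open>Chosen so that \<open>\<theta> * r ^ n = 2 * M\<close>: regularity then gives
    measure \<open>2 * M\<close> in the ball, and at least \<open>M\<close> is left after removing
    \<open>A\<close>. The assumption \<open>half\<close> makes this radius admissible.\<close>
  define r where "r = (2 * M / \<theta>) powr (1 / real ?n)"
  have r: "r > 0" using M0 \<theta> by (simp add: r_def)
  have rn: "r ^ ?n = 2 * M / \<theta>"
    using M0 \<theta> r by (simp add: powr_realpow[symmetric]) (simp add: r_def powr_powr)
  have ra: "M powr (a / real ?n) \<le> r powr a"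
  proof -
    have "M \<le> 2 * M / \<theta>" using \<theta> M0 by (simp add: field_simps)
    then have "M powr (a / real ?n) \<le> (2 * M / \<theta>) powr (a / real ?n)"
      using a M0 by (intro powr_mono2) auto
    then show ?thesis by (simp add: r_def powr_powr)
  qed
  define S where "S = ball x r \<inter> \<Omega> - A"
  have S: "S \<in> sets lebesgue" using \<Omega> A unfolding S_def by (intro sets.Diff sets.Int) auto
  have Sfin: "emeasure lebesgue S < \<infinity>"
    by (rule le_less_trans[OF emeasure_mono[of _ "ball x r"]]) (use emeasure_bounded_finite[of "ball x r"] in \<open>auto simp: S_def\<close>)
  have "2 * M \<le> measure lebesgue (ball x r \<inter> \<Omega>)"
  proof -
    have "ennreal (\<theta> * r ^ ?n) \<le> emeasure lebesgue \<Omega>"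
      using half \<theta> M0 by (simp add: rn eA ennreal_mult)
    from reg[OF _ r this, of x] x A \<theta> show ?thesis by (auto simp: rn)
  qed
  also have "\<dots> \<le> measure lebesgue (S \<union> A)"
    using S A fin Sfin
    by (intro measure_mono_fmeasurable fmeasurable.Un fmeasurableI) (auto simp: S_def \<Omega>)
  also have "\<dots> \<le> measure lebesgue S + M"
    unfolding M_def using S A by (intro measure_Un_le)
  finally have MS: "M \<le> measure lebesgue S" by simp
  \<comment> \<open>A lower bound for the integrand on all of \<open>S\<close>. Since
    \<open>r ^ (2 * n) = 4 * M\<^sup>2 / \<theta>\<^sup>2\<close>, multiplying it by
    \<open>M\<close> produces the constant \<open>\<theta>\<^sup>2 / (4 * K)\<close> of the
    claim.\<close>
  define c where "c = phi (h * r powr a) / (K * r ^ (2 * ?n))"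
  have c0: "c \<ge> 0" using young_nonneg[OF phi, of "h * r powr a"] h K r by (simp add: c_def)
  have "\<theta>\<^sup>2 / (4 * K) * phi (h * M powr (a / real ?n)) / M
      \<le> \<theta>\<^sup>2 / (4 * K) * phi (h * r powr a) / M"
    using \<theta> K M0 h ra
    by (intro divide_right_mono mult_left_mono young_mono[OF phi]) auto
  also have "\<dots> = c * M"
    using M0 \<theta> K by (simp add: c_def power_mult mult.commute[of 2] rn power2_eq_square field_simps)
  also have "\<dots> \<le> c * measure lebesgue S"
    using MS c0 by (intro mult_left_mono)
  finally have "ennreal (\<theta>\<^sup>2 / (4 * K) * phi (h * M powr (a / real ?n)) / M)
      \<le> ennreal (c * measure lebesgue S)" by (rule ennreal_leI)
  also have "\<dots> = (\<integral>\<^sup>+ y. ennreal c * indicator S y \<partial>lebesgue)"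
    using S Sfin c0 by (simp add: nn_integral_cmult_indicator ennreal_mult emeasure_eq_ennreal_measure)
  also have "\<dots> \<le> (\<integral>\<^sup>+ y\<in>\<Omega> - A. ennreal (phi (h * norm (x - y) powr a) / norm (x - y) ^ (2 * ?n)) \<partial>lebesgue)"
  proof (intro nn_integral_mono)
    fix y
    show "ennreal c * indicator S y
      \<le> ennreal (phi (h * norm (x - y) powr a) / norm (x - y) ^ (2 * ?n)) * indicator (\<Omega> - A) y"
    proof (cases "y \<in> S")
      case True
      define s where "s = norm (x - y)"
      have s: "0 < s" "s \<le> r" using True x by (auto simp: s_def S_def dist_norm)
      have "phi (h * r powr a) = phi ((r / s) powr a * (h * s powr a))"
        using s r by (simp add: powr_divide mult.commute)
      also have "\<dots> \<le> K * ((r / s) powr a) powr (real ?n / a) * phi (h * s powr a)"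
        using s r a h by (intro growth ge_one_powr_ge_zero) auto
      also have "((r / s) powr a) powr (real ?n / a) = (r / s) ^ ?n"
        using s r a by (simp add: powr_powr powr_realpow)
      finally have "phi (h * r powr a) \<le> K * (r / s) ^ ?n * phi (h * s powr a)" .
      then have "c \<le> (r / s) ^ ?n * phi (h * s powr a) / r ^ (2 * ?n)"
        unfolding c_def using K r by (simp add: field_simps)
      also have "\<dots> = phi (h * s powr a) / (s ^ ?n * r ^ ?n)"
        using s r by (simp add: power_divide mult_2 power_add)
      also have "\<dots> \<le> phi (h * s powr a) / (s ^ ?n * s ^ ?n)"
        using s r h young_nonneg[OF phi, of "h * s powr a"]
        by (intro divide_left_mono mult_left_mono power_mono) auto
      also have "s ^ ?n * s ^ ?n = s ^ (2 * ?n)" by (simp add: mult_2 power_add)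
      finally show ?thesis using True by (auto simp: s_def S_def intro: ennreal_leI)
    qed auto
  qed
  finally show ?thesis by (simp add: M_def)
qed

text \<open>For \<open>x\<close> in level set \<open>k\<close>, the preceding lemma with
  \<open>A (k - 1)\<close> as the removed set bounds the interaction of \<open>x\<close> with points
  outside \<open>A (k - 1)\<close>. Integrating over \<open>A k\<close> produces the factor
  \<open>m k\<close>. All levels can be summed inside one modular because the contributions of a
  single pair of points are controlled by the lemma on separating levels.\<close>

lemma level_set_sum_le:
  fixes \<Omega> :: "'a::euclidean_space set" and u v :: "'a \<Rightarrow> real" and F :: "int set"
  assumes phi: "young_function phi" and \<alpha>: "\<alpha> < 0" and K: "K \<ge> 1"
    and growth: "\<And>s x. s \<ge> 1 \<Longrightarrow> x \<ge> 0 \<Longrightarrow> phi (s * x) \<le> K * s powr (real DIM('a) / (- \<alpha>)) * phi x"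
    and \<theta>: "0 < \<theta>" "\<theta> < 1"
    and reg: "\<And>x r. x \<in> \<Omega> \<Longrightarrow> r > 0 \<Longrightarrow> ennreal (\<theta> * r ^ DIM('a)) \<le> emeasure lebesgue \<Omega>
       \<Longrightarrow> \<theta> * r ^ DIM('a) \<le> measure lebesgue (ball x r \<inter> \<Omega>)"
    and \<Omega>: "\<Omega> \<in> sets lebesgue"
    and v: "v \<in> borel_measurable lebesgue"
    and fin: "emeasure lebesgue {x\<in>\<Omega>. v x > 0} < \<infinity>"
    and half: "2 * emeasure lebesgue {x\<in>\<Omega>. v x > 0} \<le> emeasure lebesgue \<Omega>"
    and lam: "lam > 0" and mod1: "besov_modular \<alpha> phi \<Omega> u lam \<le> 1"
    and vu: "\<And>x y. x \<in> \<Omega> \<Longrightarrow> y \<in> \<Omega> \<Longrightarrow> \<bar>v x - v y\<bar> \<le> \<bar>u x - u y\<bar> / lam"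
    and F: "finite F"
  defines "m \<equiv> \<lambda>k::int. measure lebesgue {x\<in>\<Omega>. v x > 2 powr real_of_int k}"
  shows "(\<Sum>k\<in>F. m k / m (k - 1) * phi (2 powr real_of_int (k - 1) * m (k - 1) powr (- \<alpha> / real DIM('a))))
     \<le> 8 * K / \<theta>\<^sup>2"
proof -
  let ?n = "DIM('a)"
  define A where "A k = {x\<in>\<Omega>. v x > 2 powr real_of_int k}" for k :: int
  have A_sets [measurable]: "A k \<in> sets lebesgue" for k
  proof -
    have "A k = \<Omega> \<inter> (v -` {2 powr real_of_int k<..} \<inter> space lebesgue)" by (auto simp: A_def)
    moreover have "v -` {2 powr real_of_int k<..} \<inter> space lebesgue \<in> sets lebesgue"
      by (rule measurable_sets[OF v]) simp
    ultimately show ?thesis using \<Omega> by simp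
  qed
  have pos_sets: "{x\<in>\<Omega>. v x > 0} \<in> sets lebesgue"
  proof -
    have "{x\<in>\<Omega>. v x > 0} = \<Omega> \<inter> (v -` {0<..} \<inter> space lebesgue)" by auto
    moreover have "v -` {0<..} \<inter> space lebesgue \<in> sets lebesgue"
      by (rule measurable_sets[OF v]) simp
    ultimately show ?thesis using \<Omega> by simp
  qed
  have A_sub: "A k \<subseteq> {x\<in>\<Omega>. v x > 0}" for k
  proof
    fix x assume "x \<in> A k"
    then have "x \<in> \<Omega>" "2 powr real_of_int k < v x" by (simp_all add: A_def)
    moreover have "(0::real) < 2 powr real_of_int k" by simp
    ultimately show "x \<in> {x\<in>\<Omega>. v x > 0}" by (metis (mono_tags) less_trans mem_Collect_eq)
  qed
  have A_le: "emeasure lebesgue (A k) \<le> emeasure lebesgue {x\<in>\<Omega>. v x > 0}" for k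
    by (rule emeasure_mono[OF A_sub pos_sets])
  have A_fin: "emeasure lebesgue (A k) < \<infinity>" for k using A_le fin by (rule le_less_trans)
  have A_half: "2 * emeasure lebesgue (A k) \<le> emeasure lebesgue \<Omega>" for k
  proof -
    have "2 * emeasure lebesgue (A k) \<le> 2 * emeasure lebesgue {x\<in>\<Omega>. v x > 0}"
      by (rule mult_left_mono[OF A_le]) simp
    then show ?thesis using half by (rule order_trans)
  qed
  have mA: "m k = measure lebesgue (A k)" for k unfolding m_def A_def by (rule refl)
  have A_dec: "A k \<subseteq> A (k - 1)" for k
  proof
    fix x assume "x \<in> A k"
    then have "x \<in> \<Omega>" "2 powr real_of_int k < v x" by (simp_all add: A_def)
    moreover have "2 powr real_of_int (k - 1) \<le> 2 powr real_of_int k" by (rule powr_mono) auto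
    ultimately show "x \<in> A (k - 1)"
      unfolding A_def by (metis (mono_tags) le_less_trans mem_Collect_eq)
  qed
  define g where "g k x y = ennreal (phi (2 powr real_of_int (k - 1) * norm (x - y) powr (- \<alpha>)) / norm (x - y) ^ (2 * ?n))"
    for k :: int and x y :: 'a
  \<comment> \<open>Half of the lower bound for the inner integral: the halving is the one in
    \<open>young_sum_separating_levels_le\<close>.\<close>
  define c where "c k = \<theta>\<^sup>2 / (8 * K) * (phi (2 powr real_of_int (k - 1) * m (k - 1) powr (- \<alpha> / real ?n)) / m (k - 1))"
    for k :: int
  have c0: "c k \<ge> 0" for k
    using K young_nonneg[OF phi] by (simp add: c_def mA)
  have inner: "(\<Sum>k\<in>F. ennreal (c k) * indicator (A k) x)
      \<le> (\<integral>\<^sup>+ y\<in>\<Omega>. ennreal (phi (\<bar>u x - u y\<bar> / (lam * norm (x - y) powr \<alpha>)) / norm (x - y) ^ (2 * ?n)) \<partial>lebesgue)"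
    if x: "x \<in> \<Omega>" for x
  proof -
    have g_meas: "g k x \<in> borel_measurable lebesgue" for k
    proof -
      define psi where "psi = (\<lambda>t. phi \<bar>t\<bar>)"
      have [measurable]: "psi \<in> borel_measurable borel"
        unfolding psi_def by (rule young_abs_measurable[OF phi])
      have "g k x = (\<lambda>y. ennreal (psi (2 powr real_of_int (k - 1) * norm (x - y) powr (- \<alpha>)) / norm (x - y) ^ (2 * ?n)))"
        by (simp add: g_def psi_def fun_eq_iff)
      also have "\<dots> \<in> borel_measurable lborel" by measurable
      finally show ?thesis by (rule measurable_completion)
    qed
    have gA_meas: "(\<lambda>y. g k x y * indicator (\<Omega> - A (k - 1)) y) \<in> borel_measurable lebesgue" for k
      using \<Omega> by (intro borel_measurable_times_ennreal g_meas borel_measurable_indicator sets.Diff A_sets)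
    have "(\<Sum>k\<in>F. ennreal (c k) * indicator (A k) x)
       \<le> (\<Sum>k\<in>F. (\<integral>\<^sup>+ y. ennreal (1/2) * (g k x y * indicator (\<Omega> - A (k - 1)) y) * indicator (A k) x \<partial>lebesgue))"
    proof (intro sum_mono)
      fix k
      show "ennreal (c k) * indicator (A k) x
         \<le> (\<integral>\<^sup>+ y. ennreal (1/2) * (g k x y * indicator (\<Omega> - A (k - 1)) y) * indicator (A k) x \<partial>lebesgue)"
      proof (cases "x \<in> A k \<and> m (k - 1) > 0")
        case True
        then have xA: "x \<in> A (k - 1)" using A_dec by auto
        have "ennreal (c k) = ennreal (1/2) * ennreal (\<theta>\<^sup>2 / (4 * K) * phi (2 powr real_of_int (k - 1) * m (k - 1) powr (- \<alpha> / real ?n)) / m (k - 1))"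
          using K by (subst ennreal_mult'[symmetric]) (auto simp: c_def mult.assoc)
        also have "\<dots> \<le> ennreal (1/2) * (\<integral>\<^sup>+ y\<in>\<Omega> - A (k - 1). g k x y \<partial>lebesgue)"
        proof (rule mult_left_mono)
          have pos: "measure lebesgue (A (k - 1)) > 0" using True by (simp add: mA)
          show "ennreal (\<theta>\<^sup>2 / (4 * K) * phi (2 powr real_of_int (k - 1) * m (k - 1) powr (- \<alpha> / real ?n)) / m (k - 1))
            \<le> (\<integral>\<^sup>+ y\<in>\<Omega> - A (k - 1). g k x y \<partial>lebesgue)"
            unfolding g_def mA
            by (rule young_integral_outside_ge, fact phi, simp add: \<alpha>, fact K, fact growth,
                fact \<theta>(1), fact \<theta>(2), fact reg, fact \<Omega>, fact A_sets, simp add: A_def, fact A_fin,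
                fact A_half, fact pos, fact xA, simp)
        qed simp
        also have "\<dots> = (\<integral>\<^sup>+ y. ennreal (1/2) * (g k x y * indicator (\<Omega> - A (k - 1)) y) \<partial>lebesgue)"
          by (rule nn_integral_cmult[symmetric, OF gA_meas])
        finally show ?thesis using True by simp
      next
        case False
        then show ?thesis
        proof (cases "x \<in> A k")
          case True
          \<comment> \<open>For a null level set the division by \<open>m (k - 1)\<close> in
            \<open>c k\<close> yields 0, so nothing has to be bounded.\<close>
          with False have "m (k - 1) = 0" by (simp add: mA measure_le_0_iff not_less)
          then show ?thesis by (simp add: c_def)
        qed simp
      qed
    qed
    also have "\<dots> = (\<integral>\<^sup>+ y. (\<Sum>k\<in>F. ennreal (1/2) * (g k x y * indicator (\<Omega> - A (k - 1)) y) * indicator (A k) x) \<partial>lebesgue)"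
      by (rule nn_integral_sum[symmetric]) (intro borel_measurable_times_ennreal gA_meas borel_measurable_const)
    also have "\<dots> \<le> (\<integral>\<^sup>+ y\<in>\<Omega>. ennreal (phi (\<bar>u x - u y\<bar> / (lam * norm (x - y) powr \<alpha>)) / norm (x - y) ^ (2 * ?n)) \<partial>lebesgue)"
    proof (intro nn_integral_mono)
      fix y
      show "(\<Sum>k\<in>F. ennreal (1/2) * (g k x y * indicator (\<Omega> - A (k - 1)) y) * indicator (A k) x)
        \<le> ennreal (phi (\<bar>u x - u y\<bar> / (lam * norm (x - y) powr \<alpha>)) / norm (x - y) ^ (2 * ?n)) * indicator \<Omega> y"
      proof (cases "y \<in> \<Omega>")
        case y: True
        define d where "d = norm (x - y) powr (- \<alpha>)"
        define p where "p k = (if 2 powr real_of_int k < v x \<and> v y \<le> 2 powr real_of_int (k - 1)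
           then phi (2 powr real_of_int (k - 1) * d) / 2 else 0)" for k :: int
        have p0: "p k \<ge> 0" for k using young_nonneg[OF phi] by (simp add: p_def d_def)
        have "(\<Sum>k\<in>F. ennreal (1/2) * (g k x y * indicator (\<Omega> - A (k - 1)) y) * indicator (A k) x)
          = (\<Sum>k\<in>F. ennreal (p k / norm (x - y) ^ (2 * ?n)))"
        proof (intro sum.cong refl)
          fix k
          show "ennreal (1/2) * (g k x y * indicator (\<Omega> - A (k - 1)) y) * indicator (A k) x
             = ennreal (p k / norm (x - y) ^ (2 * ?n))"
          proof (cases "2 powr real_of_int k < v x \<and> v y \<le> 2 powr real_of_int (k - 1)")
            case True
            then have "x \<in> A k" "y \<in> \<Omega> - A (k - 1)" using x y by (auto simp: A_def)
            moreover have "p k / norm (x - y) ^ (2 * ?n)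
               = 1 / 2 * (phi (2 powr real_of_int (k - 1) * d) / norm (x - y) ^ (2 * ?n))"
              using True by (simp add: p_def)
            ultimately show ?thesis
              by (simp only: g_def d_def ennreal_mult' indicator_simps mult_1_right)
          next
            case False
            then have "x \<notin> A k \<or> y \<notin> \<Omega> - A (k - 1)" using x y by (auto simp: A_def)
            moreover have "p k = 0" using False by (auto simp: p_def)
            ultimately show ?thesis by auto
          qed
        qed
        also have "\<dots> = ennreal ((\<Sum>k\<in>F. p k) / norm (x - y) ^ (2 * ?n))"
          using p0 by (subst sum_ennreal) (auto simp: sum_divide_distrib)
        also have "\<dots> \<le> ennreal (phi (\<bar>u x - u y\<bar> / (lam * norm (x - y) powr \<alpha>)) / norm (x - y) ^ (2 * ?n))"
        proof (intro ennreal_leI divide_right_mono)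
          \<comment> \<open>Only here are the levels combined: \<open>p k\<close> is the
            contribution of this pair when levels \<open>k - 1\<close> and \<open>k\<close> separate
            \<open>v y\<close> from \<open>v x\<close>.\<close>
          have "(\<Sum>k\<in>F. p k) \<le> phi (\<bar>v x - v y\<bar> * d)"
            unfolding p_def by (rule young_sum_separating_levels_le[OF phi F]) (simp add: d_def)
          also have "\<dots> \<le> phi (\<bar>u x - u y\<bar> / lam * d)"
            using vu[OF x y] by (intro young_mono[OF phi] mult_right_mono) (auto simp: d_def)
          also have "\<bar>u x - u y\<bar> / lam * d = \<bar>u x - u y\<bar> / (lam * norm (x - y) powr \<alpha>)"
            by (simp add: d_def powr_minus divide_inverse)
          finally show "(\<Sum>k\<in>F. p k) \<le> phi (\<bar>u x - u y\<bar> / (lam * norm (x - y) powr \<alpha>))" .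
        qed simp
        finally show ?thesis using y by simp
      qed simp
    qed
    finally show ?thesis .
  qed
  have "ennreal (\<Sum>k\<in>F. c k * m k) = (\<Sum>k\<in>F. ennreal (c k * m k))"
    using c0 by (intro sum_ennreal[symmetric]) (simp add: mA)
  also have "\<dots> = (\<Sum>k\<in>F. ennreal (c k) * emeasure lebesgue (A k))"
  proof (intro sum.cong refl)
    fix k
    have "emeasure lebesgue (A k) = ennreal (m k)"
      unfolding mA using A_fin[of k] by (intro emeasure_eq_ennreal_measure) simp
    then show "ennreal (c k * m k) = ennreal (c k) * emeasure lebesgue (A k)"
      by (simp add: ennreal_mult'[OF c0])
  qed
  also have "\<dots> = (\<integral>\<^sup>+ x. (\<Sum>k\<in>F. ennreal (c k) * indicator (A k) x) \<partial>lebesgue)"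
    by (subst nn_integral_sum) (auto simp: nn_integral_cmult_indicator)
  also have "\<dots> \<le> besov_modular \<alpha> phi \<Omega> u lam"
    unfolding besov_modular_def
  proof (intro nn_integral_mono)
    fix x
    show "(\<Sum>k\<in>F. ennreal (c k) * indicator (A k) x)
      \<le> (\<integral>\<^sup>+ y\<in>\<Omega>. ennreal (phi (\<bar>u x - u y\<bar> / (lam * norm (x - y) powr \<alpha>)) / norm (x - y) ^ (2 * ?n)) \<partial>lebesgue) * indicator \<Omega> x"
      using inner[of x] by (cases "x \<in> \<Omega>") (auto simp: A_def)
  qed
  finally have "ennreal (\<Sum>k\<in>F. c k * m k) \<le> 1" using mod1 by (rule order_trans)
  then have "(\<Sum>k\<in>F. c k * m k) \<le> 1" by (simp add: ennreal_le_1)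
  moreover have "(\<Sum>k\<in>F. c k * m k) = \<theta>\<^sup>2 / (8 * K) *
    (\<Sum>k\<in>F. m k / m (k - 1) * phi (2 powr real_of_int (k - 1) * m (k - 1) powr (- \<alpha> / real ?n)))"
    (is "_ = _ * ?S")
    unfolding sum_distrib_left by (intro sum.cong refl) (simp add: c_def)
  ultimately have "\<theta>\<^sup>2 / (8 * K) * ?S \<le> 1" by (simp only:)
  moreover have "\<theta>\<^sup>2 / (8 * K) * S \<le> 1 \<Longrightarrow> S \<le> 8 * K / \<theta>\<^sup>2" for S :: real
    using K \<theta> by (simp add: field_simps)
  ultimately show ?thesis by blast
qed

section \<open>From weighted level sums to the integral of a power\<close>

text \<open>The hypothesis carries the weight \<open>m k / m (k - 1)\<close>, which may be small.
  With \<open>b k = 2 powr k * m k powr (1 / q)\<close>, a small weight means that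
  \<open>b k\<close> is at most half of \<open>b (k - 1)\<close>, and convexity then gives a
  contraction by 1/2; otherwise the weight is bounded below or controls the growth of
  \<open>phi\<close>. Summing and absorbing the contracted part bounds the unweighted sum.
  \<open>C\<close> depends on neither \<open>m\<close> nor \<open>A\<close>; these affect only
  \<open>N0\<close>.\<close>

lemma dyadic_sum_bound:
  assumes phi: "young_function phi" and q: "q > 0" and K: "K \<ge> 1" and c: "c \<ge> 0"
    and growth: "\<And>s x. s \<ge> 1 \<Longrightarrow> x \<ge> 0 \<Longrightarrow> phi (s * x) \<le> K * s powr q * phi x"
  obtains C where "C > 0"
    "\<And>(m :: int \<Rightarrow> real) A. \<lbrakk>\<And>k. 0 \<le> m k; \<And>k. m k \<le> m (k - 1); \<And>k. m k \<le> A;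
       \<And>F. finite F \<Longrightarrow>
         (\<Sum>k\<in>F. m k / m (k - 1) * phi (2 powr real_of_int (k - 1) * m (k - 1) powr (1 / q))) \<le> c\<rbrakk>
     \<Longrightarrow> \<exists>N0. \<forall>N\<ge>N0. (\<Sum>k\<in>{- int N..int N}. 2 powr (real_of_int k * q) * m k) \<le> C"
proof -
  \<comment> \<open>If \<open>b k\<close> is at least half of \<open>b (k - 1)\<close>, then
    \<open>4 powr q * (m k / m (k - 1)) \<ge> 1\<close>.\<close>
  define K' where "K' = K * 4 powr q"
  have K': "K' \<ge> 0" using K by (simp add: K'_def)
  \<comment> \<open>The bound obtained by solving \<open>T \<le> K' * c + (1 + T) / 2\<close> for
    \<open>T\<close>.\<close>
  define c2 where "c2 = 2 * K' * c + 1"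
  have c2: "c2 \<ge> 1" using K' c by (simp add: c2_def)
  have "filterlim phi at_top at_top" using phi by (simp add: young_function_def)
  then have "eventually (\<lambda>x. phi x > c2 \<and> x \<ge> 1) at_top"
    unfolding filterlim_at_top_dense using eventually_ge_at_top eventually_conj by blast
  then obtain B where B: "phi B > c2" "B \<ge> 1"
    by (metis (mono_tags, lifting) eventually_at_top_linorder order_refl)
  define C where "C = K * B powr q / phi B * c2"
  show thesis
  proof
    show "C > 0" using K B c2 by (simp add: C_def)
    fix m :: "int \<Rightarrow> real" and A :: real
    assume m0: "\<And>k. 0 \<le> m k" and mdec: "\<And>k. m k \<le> m (k - 1)" and mA: "\<And>k. m k \<le> A"
      and sums: "\<And>F. finite F \<Longrightarrow>
         (\<Sum>k\<in>F. m k / m (k - 1) * phi (2 powr real_of_int (k - 1) * m (k - 1) powr (1 / q))) \<le> c"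
    define b where "b k = 2 powr real_of_int k * m k powr (1 / q)" for k :: int
    have b0: "b k \<ge> 0" for k by (simp add: b_def)
    have phib: "phi (b k) \<ge> 0" for k using young_nonneg[OF phi b0] .
    have step: "phi (b k) \<le> K' * (m k / m (k - 1) * phi (b (k - 1))) + phi (b (k - 1)) / 2" for k
    proof (cases "m k = 0")
      case True
      then have "b k = 0" by (simp add: b_def)
      then show ?thesis using True phib[of "k - 1"] phi by (simp add: young_function_def)
    next
      case False
      then have mk: "m k > 0" "m (k - 1) > 0" using m0[of k] mdec[of k] by auto
      \<comment> \<open>The ratio of \<open>b k\<close> to \<open>b (k - 1)\<close>. The growth
        bound serves ratios above 1, monotonicity those between 1/2 and 1, convexity those below
        1/2.\<close>
      define \<rho> where "\<rho> = 2 * (m k / m (k - 1)) powr (1 / q)"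
      have \<rho>: "\<rho> > 0" using mk by (simp add: \<rho>_def)
      have \<rho>q: "\<rho> powr q = 2 powr q * (m k / m (k - 1))"
        using mk q by (simp add: \<rho>_def powr_mult powr_powr)
      have bk: "b k = \<rho> * b (k - 1)"
        using mk by (simp add: b_def \<rho>_def powr_divide powr_diff)
      consider "\<rho> \<ge> 1" | "1/2 \<le> \<rho>" "\<rho> \<le> 1" | "\<rho> \<le> 1/2" by linarith
      then show ?thesis
      proof cases
        case 1
        have "phi (b k) \<le> K * \<rho> powr q * phi (b (k - 1))"
          unfolding bk by (rule growth[OF 1 b0])
        also have "\<dots> = (K * 2 powr q) * (m k / m (k - 1) * phi (b (k - 1)))" by (simp add: \<rho>q)
        also have "\<dots> \<le> K' * (m k / m (k - 1) * phi (b (k - 1)))"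
          unfolding K'_def using mk phib[of "k - 1"] K q
          by (intro mult_right_mono mult_left_mono powr_mono2) auto
        finally show ?thesis using phib[of "k - 1"] by linarith
      next
        case 2
        have "(1::real) \<le> (2 * \<rho>) powr q" using 2 q by (intro ge_one_powr_ge_zero) auto
        also have "\<dots> = 4 powr q * (m k / m (k - 1))"
        proof -
          have "(2 * \<rho>) powr q = (2 powr q * 2 powr q) * (m k / m (k - 1))"
            using \<rho> by (simp add: powr_mult \<rho>q)
          also have "2 powr q * 2 powr q = (4::real) powr q"
            by (subst powr_mult[symmetric]) auto
          finally show ?thesis .
        qed
        also have "\<dots> \<le> K' * (m k / m (k - 1))"
          unfolding K'_def using K mk by (intro mult_right_mono) auto
        finally have "1 * phi (b (k - 1)) \<le> K' * (m k / m (k - 1)) * phi (b (k - 1))"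
          using phib[of "k - 1"] by (intro mult_right_mono) auto
        moreover have "phi (b k) \<le> phi (b (k - 1))"
          using bk 2 b0[of k] b0[of "k - 1"] \<rho>
          by (intro young_mono[OF phi]) (auto simp: mult_left_le_one_le)
        ultimately show ?thesis using phib[of "k - 1"] by (simp add: mult.assoc)
      next
        case 3
        have "phi (b k) \<le> \<rho> * phi (b (k - 1))"
          unfolding bk using 3 \<rho> b0 by (intro young_scale[OF phi]) auto
        also have "\<dots> \<le> 1/2 * phi (b (k - 1))"
          using 3 phib[of "k - 1"] by (intro mult_right_mono) auto
        moreover have "0 \<le> K' * (m k / m (k - 1) * phi (b (k - 1)))"
          using K' mk phib[of "k - 1"] by simp
        ultimately show ?thesis by linarith
      qed
    qed
    define X where "X = max A 1 powr (1 / q)"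
    have X: "X \<ge> 0" by (simp add: X_def)
    obtain N0 :: nat where N0: "phi X \<le> real N0" using real_arch_simple by blast
    \<comment> \<open>Shifting the index by one leaves this single term below the range. It is
      harmless for large \<open>N\<close>: \<open>m\<close> is bounded by \<open>A\<close>, so the
      argument is at most \<open>X\<close> times a factor below \<open>1 / 2 ^ N\<close>, and
      \<open>phi X \<le> N\<close>.\<close>
    have low: "phi (b (- int N - 1)) \<le> 1" if "N \<ge> N0" for N
    proof -
      define t where "t = 2 powr real_of_int (- int N - 1)"
      have t: "0 < t" "t * 2 ^ N \<le> 1"
      proof -
        have "t * 2 ^ N = 2 powr (- 1)"
          by (simp add: t_def powr_realpow[symmetric] powr_add[symmetric])
        then show "t * 2 ^ N \<le> 1" by simp
      qed (simp add: t_def)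
      have t1: "t \<le> 1" unfolding t_def using powr_mono[of "real_of_int (- int N - 1)" 0 2] by simp
      have "b (- int N - 1) \<le> t * X"
        unfolding b_def t_def X_def using q m0 mA
        by (intro mult_left_mono powr_mono2) (auto intro: max.coboundedI1)
      then have "phi (b (- int N - 1)) \<le> phi (t * X)" by (intro young_mono[OF phi] b0)
      also have "\<dots> \<le> t * phi X" using t t1 X by (intro young_scale[OF phi]) auto
      also have "\<dots> \<le> t * 2 ^ N"
      proof -
        have "phi X \<le> real N" using N0 that by simp
        also have "\<dots> \<le> 2 ^ N" using of_nat_less_two_power[of N] by (simp add: less_imp_le)
        finally show ?thesis using t by (intro mult_left_mono) auto
      qed
      finally show ?thesis using t by simp
    qed
    have "(\<Sum>k\<in>{- int N..int N}. 2 powr (real_of_int k * q) * m k) \<le> C" if N: "N \<ge> N0" for N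
    proof -
      let ?I = "{- int N..int N}"
      define T where "T = (\<Sum>k\<in>?I. phi (b k))"
      have "(\<Sum>k\<in>?I. phi (b (k - 1))) = (\<Sum>k\<in>(\<lambda>k. k - 1) ` ?I. phi (b k))"
        by (subst sum.reindex) (auto simp: inj_on_def)
      also have "\<dots> \<le> (\<Sum>k\<in>insert (- int N - 1) ?I. phi (b k))"
        using phib by (intro sum_mono2) auto
      also have "\<dots> \<le> 1 + T" using low[OF N] by (simp add: T_def)
      finally have shift: "(\<Sum>k\<in>?I. phi (b (k - 1))) \<le> 1 + T" .
      have "T \<le> (\<Sum>k\<in>?I. K' * (m k / m (k - 1) * phi (b (k - 1))) + phi (b (k - 1)) / 2)"
        unfolding T_def by (intro sum_mono step)
      also have "\<dots> = K' * (\<Sum>k\<in>?I. m k / m (k - 1) * phi (b (k - 1))) + (\<Sum>k\<in>?I. phi (b (k - 1))) / 2"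
        by (simp add: sum.distrib sum_distrib_left sum_divide_distrib)
      also have "\<dots> \<le> K' * c + (1 + T) / 2"
        using K' shift sums[of ?I] unfolding b_def
        by (intro add_mono mult_left_mono divide_right_mono) auto
      \<comment> \<open>Absorbing \<open>T / 2\<close> is legitimate because \<open>T\<close> is a
        finite sum of reals; this is why the index range is truncated.\<close>
      finally have T: "T \<le> c2" by (simp add: c2_def field_simps)
      have each: "2 powr (real_of_int k * q) * m k \<le> K * B powr q / phi B * phi (b k)" if k: "k \<in> ?I" for k
      proof -
        have eq: "2 powr (real_of_int k * q) * m k = b k powr q"
          using m0[of k] q by (simp add: b_def powr_mult powr_powr)
        show ?thesis
        proof (cases "b k = 0")
          case True
          then show ?thesis unfolding eq using q B c2 phi K by (simp add: young_function_def)
        next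
          case False
          then have bk: "b k > 0" using b0[of k] by simp
          have "phi (b k) \<le> T" unfolding T_def using k phib by (intro member_le_sum) auto
          then have "phi (b k) < phi B" using T B by simp
          \<comment> \<open>Below the threshold \<open>B\<close> the growth bound can be read
            backwards: scaling \<open>b k\<close> up to \<open>B\<close> shows that
            \<open>phi (b k)\<close> is at least a multiple of \<open>b k powr q\<close>.\<close>
          then have "b k \<le> B" using young_mono[OF phi, of B "b k"] B by linarith
          then have "phi (B / b k * b k) \<le> K * (B / b k) powr q * phi (b k)"
            using bk by (intro growth) auto
          then have "phi B \<le> K * B powr q / b k powr q * phi (b k)"
            using bk B by (simp add: powr_divide)
          then show ?thesis unfolding eq using bk B c2 by (simp add: field_simps)
        qed
      qed
      have "(\<Sum>k\<in>?I. 2 powr (real_of_int k * q) * m k) \<le> (\<Sum>k\<in>?I. K * B powr q / phi B * phi (b k))"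
        by (intro sum_mono each)
      also have "\<dots> = K * B powr q / phi B * T" by (simp add: T_def sum_distrib_left)
      also have "\<dots> \<le> C" unfolding C_def using T K B c2 by (intro mult_left_mono) auto
      finally show ?thesis .
    qed
    then show "\<exists>N0. \<forall>N\<ge>N0. (\<Sum>k\<in>{- int N..int N}. 2 powr (real_of_int k * q) * m k) \<le> C" by blast
  qed
qed

lemma powr_le_sum_dyadic_levels:
  fixes t q :: real and N :: nat
  assumes q: "q > 0" and t: "2 powr (- real N) < t" "t \<le> 2 powr (real N + 1)"
  shows "t powr q \<le> 2 powr q * (\<Sum>k\<in>{- int N..int N}. if 2 powr real_of_int k < t then 2 powr (real_of_int k * q) else 0)"
proof -
  have t0: "t > 0" using t(1) powr_gt_zero[of 2 "- real N"] by linarith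
  \<comment> \<open>Ceiling minus one, rather than floor, gives the strict inequality on the left in
    \<open>2 powr k < t \<le> 2 powr (k + 1)\<close>, matching the strict level sets.\<close>
  define k where "k = \<lceil>log 2 t\<rceil> - 1"
  have k: "real_of_int k < log 2 t" "log 2 t \<le> real_of_int k + 1"
    unfolding k_def by linarith+
  have k1: "2 powr real_of_int k < t" and k2: "t \<le> 2 powr (real_of_int k + 1)"
    using k t0 by (auto simp: less_log_iff log_le_iff)
  have "2 powr (- real N) < 2 powr (real_of_int k + 1)" using t k2 by linarith
  then have 1: "- int N \<le> k" by simp
  have "2 powr real_of_int k < 2 powr (real N + 1)" using t k1 by linarith
  then have 2: "k \<le> int N" by simp
  have "t powr q \<le> (2 powr (real_of_int k + 1)) powr q"
    using k2 t0 q by (intro powr_mono2) auto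
  also have "\<dots> = 2 powr q * (if 2 powr real_of_int k < t then 2 powr (real_of_int k * q) else 0)"
    using k1 by (simp add: powr_powr powr_add[symmetric] algebra_simps)
  also have "\<dots> \<le> 2 powr q * (\<Sum>k\<in>{- int N..int N}. if 2 powr real_of_int k < t then 2 powr (real_of_int k * q) else 0)"
    using 1 2 by (intro mult_left_mono member_le_sum) auto
  finally show ?thesis .
qed

text \<open>The common core of both embeddings, with a constant independent of \<open>u\<close>,
  \<open>v\<close> and \<open>lam\<close>. The power of \<open>v\<close> is compared with the dyadic
  sum over its level sets on a truncation of \<Omega> by values, and monotone convergence removes
  the truncation.\<close>

lemma regular_Lp_bound:
  fixes \<Omega> :: "'a::euclidean_space set"
  assumes phi: "young_function phi" and \<alpha>: "\<alpha> < 0"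
    and up: "upper_Lambda DIM('a) phi \<alpha> < \<infinity>"
    and \<theta>: "0 < \<theta>" "\<theta> < 1"
    and reg: "\<And>x r. x \<in> \<Omega> \<Longrightarrow> r > 0 \<Longrightarrow> ennreal (\<theta> * r ^ DIM('a)) \<le> emeasure lebesgue \<Omega>
       \<Longrightarrow> \<theta> * r ^ DIM('a) \<le> measure lebesgue (ball x r \<inter> \<Omega>)"
    and \<Omega>: "\<Omega> \<in> sets lebesgue"
  obtains C where "C > 0"
    "\<And>u v lam. \<lbrakk>v \<in> borel_measurable lebesgue; \<And>x. x \<in> \<Omega> \<Longrightarrow> 0 \<le> v x;
       emeasure lebesgue {x\<in>\<Omega>. v x > 0} < \<infinity>;
       2 * emeasure lebesgue {x\<in>\<Omega>. v x > 0} \<le> emeasure lebesgue \<Omega>;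
       lam > 0; besov_modular \<alpha> phi \<Omega> u lam \<le> 1;
       \<And>x y. x \<in> \<Omega> \<Longrightarrow> y \<in> \<Omega> \<Longrightarrow> \<bar>v x - v y\<bar> \<le> \<bar>u x - u y\<bar> / lam\<rbrakk>
     \<Longrightarrow> (\<integral>\<^sup>+ x\<in>\<Omega>. ennreal (v x powr (real DIM('a) / (- \<alpha>))) \<partial>lebesgue) \<le> ennreal C"
proof -
  define q where "q = real DIM('a) / (- \<alpha>)"
  have q: "q > 0" using \<alpha> unfolding q_def by (intro divide_pos_pos) auto
  have q_inv: "- \<alpha> / real DIM('a) = 1 / q" by (simp add: q_def)
  obtain K where K: "K \<ge> 1"
    and growth: "\<And>s x. s \<ge> 1 \<Longrightarrow> x \<ge> 0 \<Longrightarrow> phi (s * x) \<le> K * s powr (real DIM('a) / (- \<alpha>)) * phi x"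
    using young_growth[OF phi \<alpha> up] by blast
  have "0 \<le> 8 * K / \<theta>\<^sup>2" using K by simp
  from dyadic_sum_bound[OF phi q K this growth[folded q_def]]
  obtain C where C: "C > 0" and sum_bound:
    "\<And>(m :: int \<Rightarrow> real) A. \<lbrakk>\<And>k. 0 \<le> m k; \<And>k. m k \<le> m (k - 1); \<And>k. m k \<le> A;
       \<And>F. finite F \<Longrightarrow>
         (\<Sum>k\<in>F. m k / m (k - 1) * phi (2 powr real_of_int (k - 1) * m (k - 1) powr (1 / q))) \<le> 8 * K / \<theta>\<^sup>2\<rbrakk>
     \<Longrightarrow> \<exists>N0. \<forall>N\<ge>N0. (\<Sum>k\<in>{- int N..int N}. 2 powr (real_of_int k * q) * m k) \<le> C"
    by blast
  show thesis
  proof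
    show "2 powr q * C > 0" using C by simp
    fix u v :: "'a \<Rightarrow> real" and lam :: real
    assume v: "v \<in> borel_measurable lebesgue" and v0: "\<And>x. x \<in> \<Omega> \<Longrightarrow> 0 \<le> v x"
      and fin: "emeasure lebesgue {x\<in>\<Omega>. v x > 0} < \<infinity>"
      and half: "2 * emeasure lebesgue {x\<in>\<Omega>. v x > 0} \<le> emeasure lebesgue \<Omega>"
      and lam: "lam > 0" and mod1: "besov_modular \<alpha> phi \<Omega> u lam \<le> 1"
      and vu: "\<And>x y. x \<in> \<Omega> \<Longrightarrow> y \<in> \<Omega> \<Longrightarrow> \<bar>v x - v y\<bar> \<le> \<bar>u x - u y\<bar> / lam"
    have gt_sets: "{x\<in>\<Omega>. v x > t} \<in> sets lebesgue" for t
    proof -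
      have "{x\<in>\<Omega>. v x > t} = \<Omega> \<inter> (v -` {t<..} \<inter> space lebesgue)" by auto
      moreover have "v -` {t<..} \<inter> space lebesgue \<in> sets lebesgue"
        by (rule measurable_sets[OF v]) simp
      ultimately show ?thesis using \<Omega> by simp
    qed
    define A where "A k = {x\<in>\<Omega>. v x > 2 powr real_of_int k}" for k :: int
    have A_sets: "A k \<in> sets lebesgue" for k unfolding A_def by (rule gt_sets)
    have A_sub: "A k \<subseteq> {x\<in>\<Omega>. v x > 0}" for k
    proof
      fix x assume "x \<in> A k"
      then have "x \<in> \<Omega>" "2 powr real_of_int k < v x" by (simp_all add: A_def)
      moreover have "(0::real) < 2 powr real_of_int k" by simp
      ultimately show "x \<in> {x\<in>\<Omega>. v x > 0}" by (metis (mono_tags) less_trans mem_Collect_eq)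
    qed
    have A_fin: "A k \<in> fmeasurable lebesgue" for k
      using A_sets emeasure_mono[OF A_sub gt_sets, of k] fin by (intro fmeasurableI) auto
    have A_dec: "A k \<subseteq> A (k - 1)" for k
    proof
      fix x assume "x \<in> A k"
      then have "x \<in> \<Omega>" "2 powr real_of_int k < v x" by (simp_all add: A_def)
      moreover have "2 powr real_of_int (k - 1) \<le> 2 powr real_of_int k" by (rule powr_mono) auto
      ultimately show "x \<in> A (k - 1)"
        unfolding A_def by (metis (mono_tags) le_less_trans mem_Collect_eq)
    qed
    have sums: "(\<Sum>k\<in>F. measure lebesgue (A k) / measure lebesgue (A (k - 1)) *
        phi (2 powr real_of_int (k - 1) * measure lebesgue (A (k - 1)) powr (1 / q))) \<le> 8 * K / \<theta>\<^sup>2"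
      if "finite F" for F
      unfolding A_def q_inv[symmetric]
      by (rule level_set_sum_le, fact phi, fact \<alpha>, fact K, fact growth, fact \<theta>(1), fact \<theta>(2), fact reg,
          fact \<Omega>, fact v, fact fin, fact half, fact lam, fact mod1, fact vu, fact that)
    have "\<exists>N0. \<forall>N\<ge>N0. (\<Sum>k\<in>{- int N..int N}. 2 powr (real_of_int k * q) * measure lebesgue (A k)) \<le> C"
    proof (rule sum_bound)
      show "measure lebesgue (A k) \<le> measure lebesgue (A (k - 1))" for k
        by (rule measure_mono_fmeasurable[OF A_dec A_sets A_fin])
      show "measure lebesgue (A k) \<le> measure lebesgue {x\<in>\<Omega>. v x > 0}" for k
        using fin by (intro measure_mono_fmeasurable A_sub A_sets fmeasurableI gt_sets)
    qed (use sums in simp_all)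
    then obtain N0 where N0: "\<And>N. N \<ge> N0 \<Longrightarrow>
        (\<Sum>k\<in>{- int N..int N}. 2 powr (real_of_int k * q) * measure lebesgue (A k)) \<le> C" by blast
    define S where "S N = {x\<in>\<Omega>. v x > 2 powr (- real N)} - {x\<in>\<Omega>. v x > 2 powr (real N + 1)}" for N :: nat
    \<comment> \<open>The shift by \<open>N0\<close> makes the dyadic bound available for every
      index of the increasing sequence.\<close>
    define J where "J N x = ennreal (v x powr q) * indicator (S (N + N0)) x" for N x
    have J_meas: "J N \<in> borel_measurable lebesgue" for N
    proof -
      have "S (N + N0) \<in> sets lebesgue" unfolding S_def by (intro sets.Diff gt_sets)
      moreover have "(\<lambda>x. ennreal (v x powr q)) \<in> borel_measurable lebesgue" using v by measurable
      ultimately show ?thesis unfolding J_def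
        by (intro borel_measurable_times_ennreal borel_measurable_indicator)
    qed
    have J_le: "(\<integral>\<^sup>+ x. J N x \<partial>lebesgue) \<le> ennreal (2 powr q * C)" for N
    proof -
      let ?I = "{- int (N + N0)..int (N + N0)}"
      have "(\<integral>\<^sup>+ x. J N x \<partial>lebesgue)
        \<le> (\<integral>\<^sup>+ x. (\<Sum>k\<in>?I. ennreal (2 powr q * 2 powr (real_of_int k * q)) * indicator (A k) x) \<partial>lebesgue)"
      proof (intro nn_integral_mono)
        fix x
        show "J N x \<le> (\<Sum>k\<in>?I. ennreal (2 powr q * 2 powr (real_of_int k * q)) * indicator (A k) x)"
        proof (cases "x \<in> S (N + N0)")
          case True
          then have x: "x \<in> \<Omega>" "2 powr (- real (N + N0)) < v x" "v x \<le> 2 powr (real (N + N0) + 1)"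
            by (auto simp: S_def not_less)
          have "v x powr q \<le> 2 powr q * (\<Sum>k\<in>?I. if 2 powr real_of_int k < v x then 2 powr (real_of_int k * q) else 0)"
            by (rule powr_le_sum_dyadic_levels[OF q x(2,3)])
          also have "\<dots> = (\<Sum>k\<in>?I. 2 powr q * 2 powr (real_of_int k * q) * indicator (A k) x)"
            unfolding sum_distrib_left using x(1) by (intro sum.cong refl) (simp add: A_def)
          finally have "J N x \<le> ennreal (\<Sum>k\<in>?I. 2 powr q * 2 powr (real_of_int k * q) * indicator (A k) x)"
            using True by (simp add: J_def ennreal_leI)
          also have "\<dots> = (\<Sum>k\<in>?I. ennreal (2 powr q * 2 powr (real_of_int k * q) * indicator (A k) x))"
            by (rule sum_ennreal[symmetric]) simp
          also have "\<dots> = (\<Sum>k\<in>?I. ennreal (2 powr q * 2 powr (real_of_int k * q)) * indicator (A k) x)"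
            by (intro sum.cong refl) (simp add: indicator_def)
          finally show ?thesis .
        qed (simp add: J_def)
      qed
      also have "\<dots> = (\<Sum>k\<in>?I. ennreal (2 powr q * 2 powr (real_of_int k * q)) * emeasure lebesgue (A k))"
        using A_sets by (subst nn_integral_sum) (simp_all add: nn_integral_cmult_indicator)
      also have "\<dots> = (\<Sum>k\<in>?I. ennreal (2 powr q * (2 powr (real_of_int k * q) * measure lebesgue (A k))))"
      proof (intro sum.cong refl)
        fix k
        have "emeasure lebesgue (A k) = ennreal (measure lebesgue (A k))"
          by (rule emeasure_eq_measure2[OF A_fin])
        then show "ennreal (2 powr q * 2 powr (real_of_int k * q)) * emeasure lebesgue (A k)
          = ennreal (2 powr q * (2 powr (real_of_int k * q) * measure lebesgue (A k)))"
          by (simp add: ennreal_mult'[symmetric] mult.assoc)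
      qed
      also have "\<dots> = ennreal (2 powr q * (\<Sum>k\<in>?I. 2 powr (real_of_int k * q) * measure lebesgue (A k)))"
        unfolding sum_distrib_left by (rule sum_ennreal) simp
      also have "\<dots> \<le> ennreal (2 powr q * C)"
        using N0[of "N + N0"] by (intro ennreal_leI mult_left_mono) auto
      finally show ?thesis .
    qed
    have S_mono: "S i \<subseteq> S j" if "i \<le> j" for i j
    proof -
      have "2 powr (- real j) \<le> 2 powr (- real i)" "2 powr (real i + 1) \<le> 2 powr (real j + 1)"
        using that by (auto intro!: powr_mono)
      note le = this
      show ?thesis
      proof
        fix x assume "x \<in> S i"
        then have x: "x \<in> \<Omega>" "2 powr (- real i) < v x" "v x \<le> 2 powr (real i + 1)"
          by (simp_all add: S_def not_less)
        have "2 powr (- real j) < v x" "v x \<le> 2 powr (real j + 1)" using x le by linarith+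
        then show "x \<in> S j" using x(1) by (simp add: S_def not_less)
      qed
    qed
    have "incseq J"
      unfolding incseq_def le_fun_def J_def
    proof (intro allI impI mult_left_mono)
      fix i j :: nat and x assume "i \<le> j"
      then have "S (i + N0) \<subseteq> S (j + N0)" by (intro S_mono) simp
      then show "indicator (S (i + N0)) x \<le> (indicator (S (j + N0)) x :: ennreal)"
        by (auto simp: indicator_def)
    qed simp
    have "(\<integral>\<^sup>+ x\<in>\<Omega>. ennreal (v x powr q) \<partial>lebesgue) \<le> (\<integral>\<^sup>+ x. (SUP N. J N x) \<partial>lebesgue)"
    proof (intro nn_integral_mono)
      fix x
      show "ennreal (v x powr q) * indicator \<Omega> x \<le> (SUP N. J N x)"
      proof (cases "x \<in> \<Omega> \<and> v x > 0")
        case True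
        obtain N :: nat where N: "\<bar>log 2 (v x)\<bar> < real N" using reals_Archimedean2 by blast
        have "- real (N + N0) < log 2 (v x)" "log 2 (v x) \<le> real (N + N0) + 1" using N by auto
        then have "x \<in> S (N + N0)"
          using True by (auto simp: S_def not_less less_log_iff log_le_iff)
        then have "ennreal (v x powr q) * indicator \<Omega> x \<le> J N x" using True by (simp add: J_def)
        also have "\<dots> \<le> (SUP N. J N x)" by (rule SUP_upper) simp
        finally show ?thesis .
      next
        case False
        then have "x \<notin> \<Omega> \<or> v x = 0" using v0[of x] by force
        then show ?thesis by auto
      qed
    qed
    also have "\<dots> = (SUP N. \<integral>\<^sup>+ x. J N x \<partial>lebesgue)"
      by (rule nn_integral_monotone_convergence_SUP[OF \<open>incseq J\<close> J_meas])
    also have "\<dots> \<le> ennreal (2 powr q * C)" by (intro SUP_least J_le)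
    finally show "(\<integral>\<^sup>+ x\<in>\<Omega>. ennreal (v x powr (real DIM('a) / (- \<alpha>))) \<partial>lebesgue) \<le> ennreal (2 powr q * C)"
      unfolding q_def .
  qed
qed

section \<open>Embedding on regular domains\<close>

lemma Lp_norm_le:
  assumes "p > 0" "M \<ge> 0"
    and le: "(\<integral>\<^sup>+ x\<in>\<Omega>. ennreal (\<bar>f x\<bar> powr p) \<partial>lebesgue) \<le> ennreal (M powr p)"
  shows "Lp_norm p \<Omega> f \<le> ennreal M"
proof -
  define I where "I = (\<integral>\<^sup>+ x\<in>\<Omega>. ennreal (\<bar>f x\<bar> powr p) \<partial>lebesgue)"
  have "I \<noteq> \<infinity>" using le unfolding I_def[symmetric] by (auto simp: top_unique)
  then have "I = ennreal (enn2real I)" by (simp add: less_top)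
  then have "enn2real I \<le> M powr p" using le unfolding I_def[symmetric]
    by (metis ennreal_le_iff[OF powr_ge_zero])
  then have "enn2real I powr (1 / p) \<le> (M powr p) powr (1 / p)"
    using assms(1) by (intro powr_mono2) auto
  also have "\<dots> = M" using assms(1,2) by (simp add: powr_powr)
  finally show ?thesis
    using \<open>I \<noteq> \<infinity>\<close> unfolding Lp_norm_def Let_def I_def[symmetric] by (auto intro: ennreal_leI)
qed

lemma integral_le_of_Lp_norm_le:
  assumes "p > 0" "M \<ge> 0" and le: "Lp_norm p \<Omega> f \<le> ennreal M"
  shows "(\<integral>\<^sup>+ x\<in>\<Omega>. ennreal (\<bar>f x\<bar> powr p) \<partial>lebesgue) \<le> ennreal (M powr p)"
proof -
  define I where "I = (\<integral>\<^sup>+ x\<in>\<Omega>. ennreal (\<bar>f x\<bar> powr p) \<partial>lebesgue)"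
  have L: "Lp_norm p \<Omega> f = (if I = \<infinity> then \<infinity> else ennreal (enn2real I powr (1 / p)))"
    unfolding Lp_norm_def Let_def I_def ..
  have fin: "I \<noteq> \<infinity>" using le L by (auto simp: top_unique)
  then have "enn2real I powr (1 / p) \<le> M" using le assms(2) by (simp add: L)
  then have "(enn2real I powr (1 / p)) powr p \<le> M powr p"
    using assms(1) by (intro powr_mono2) auto
  then have "enn2real I \<le> M powr p" using assms(1) by (simp add: powr_powr)
  then have "ennreal (enn2real I) \<le> ennreal (M powr p)" by (rule ennreal_leI)
  moreover have "ennreal (enn2real I) = I" using fin by (simp add: less_top)
  ultimately show ?thesis unfolding I_def[symmetric] by (simp only:)
qed

text \<open>An estimate by every admissible \<open>lam\<close> passes to the infimum, so it is
  irrelevant whether the Luxemburg infimum is attained. Membership in the space makes the set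
  nonempty, which the real \<open>Inf\<close> requires.\<close>

lemma le_besov_normI:
  assumes u: "u \<in> besov_space \<alpha> phi \<Omega>" and C: "C > 0"
    and le: "\<And>lam. lam \<in> besov_admissible \<alpha> phi \<Omega> u \<Longrightarrow> X \<le> ennreal (C * lam)"
  shows "X \<le> ennreal (C * besov_norm \<alpha> phi \<Omega> u)"
proof -
  have ne: "besov_admissible \<alpha> phi \<Omega> u \<noteq> {}" using u by (simp add: besov_space_def)
  then obtain l0 where "l0 \<in> besov_admissible \<alpha> phi \<Omega> u" by blast
  from le[OF this] have "X \<noteq> \<infinity>" by (auto simp: top_unique)
  then obtain x where x: "X = ennreal x" "x \<ge> 0" by (cases X) auto
  have "x / C \<le> besov_norm \<alpha> phi \<Omega> u" unfolding besov_norm_def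
  proof (rule cInf_greatest[OF ne])
    fix lam assume lam: "lam \<in> besov_admissible \<alpha> phi \<Omega> u"
    then have "lam > 0" by (simp add: besov_admissible_def)
    with le[OF lam] C x have "x \<le> C * lam" by (simp add: ennreal_le_iff)
    then show "x / C \<le> lam" using C by (simp add: divide_le_eq mult.commute)
  qed
  then have "x \<le> C * besov_norm \<alpha> phi \<Omega> u" using C by (simp add: divide_le_eq mult.commute)
  then show ?thesis unfolding x by (rule ennreal_leI)
qed

section \<open>Volume and medians\<close>

text \<open>Replaces the restriction on the radius by a volume condition, which treats bounded and
  unbounded domains alike. At radii of at least twice the diameter the ball contains \<Omega>, and
  the volume condition is the conclusion itself.\<close>

lemma globally_regular_all_radii:
  fixes \<Omega> :: "'a::euclidean_space set"
  assumes "globally_regular \<Omega>"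
  shows "\<exists>\<theta>. 0 < \<theta> \<and> \<theta> < 1 \<and> (\<forall>x r. x \<in> \<Omega> \<longrightarrow> r > 0 \<longrightarrow>
      ennreal (\<theta> * r ^ DIM('a)) \<le> emeasure lebesgue \<Omega> \<longrightarrow>
      \<theta> * r ^ DIM('a) \<le> measure lebesgue (ball x r \<inter> \<Omega>))"
proof -
  obtain \<theta> where \<theta>: "0 < \<theta>" "\<theta> < 1" and reg: "\<And>x r. x \<in> \<Omega> \<Longrightarrow> 0 < r \<Longrightarrow>
      (bounded \<Omega> \<longrightarrow> r < 2 * diameter \<Omega>) \<Longrightarrow> measure lebesgue (ball x r \<inter> \<Omega>) \<ge> \<theta> * r ^ DIM('a)"
    using assms unfolding globally_regular_def by blast
  have "\<theta> * r ^ DIM('a) \<le> measure lebesgue (ball x r \<inter> \<Omega>)"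
    if x: "x \<in> \<Omega>" and r: "r > 0" and le: "ennreal (\<theta> * r ^ DIM('a)) \<le> emeasure lebesgue \<Omega>" for x r
  proof (cases "bounded \<Omega> \<longrightarrow> r < 2 * diameter \<Omega>")
    case True
    then show ?thesis using reg[OF x r] by simp
  next
    case False
    then have b: "bounded \<Omega>" and rd: "r \<ge> 2 * diameter \<Omega>" by auto
    have "dist x y < r" if "y \<in> \<Omega>" for y
      using diameter_bounded_bound[OF b x that] diameter_ge_0[OF b] rd r by linarith
    then have eq: "ball x r \<inter> \<Omega> = \<Omega>" by (auto simp: mem_ball)
    have "emeasure lebesgue (ball x r \<inter> \<Omega>) \<le> emeasure lebesgue (ball x r)"
      by (rule emeasure_mono) auto
    also have "\<dots> < \<infinity>" using emeasure_bounded_finite[of "ball x r"] by auto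
    finally have "emeasure lebesgue \<Omega> < \<infinity>" unfolding eq .
    then have "emeasure lebesgue \<Omega> = ennreal (measure lebesgue \<Omega>)"
      by (simp add: emeasure_eq_ennreal_measure)
    then show ?thesis using le unfolding eq by (simp add: ennreal_le_iff)
  qed
  with \<theta> show ?thesis by blast
qed

text \<open>Balls about one fixed point already have unbounded intersection with \<Omega>. Infinite
  volume makes the half-measure condition automatic for functions of bounded support.\<close>

lemma globally_regular_unbounded_measure:
  fixes \<Omega> :: "'a::euclidean_space set"
  assumes "globally_regular \<Omega>" and nb: "\<not> bounded \<Omega>" and ne: "\<Omega> \<noteq> {}" and \<Omega>: "\<Omega> \<in> sets lebesgue"
  shows "emeasure lebesgue \<Omega> = \<infinity>"
proof (rule ccontr)
  assume "emeasure lebesgue \<Omega> \<noteq> \<infinity>"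
  then have fm: "\<Omega> \<in> fmeasurable lebesgue" using \<Omega> by (auto intro!: fmeasurableI simp: less_top)
  obtain \<theta> where \<theta>: "0 < \<theta>" and reg: "\<And>x r. x \<in> \<Omega> \<Longrightarrow> 0 < r \<Longrightarrow>
      measure lebesgue (ball x r \<inter> \<Omega>) \<ge> \<theta> * r ^ DIM('a)"
    using assms(1) nb unfolding globally_regular_def by blast
  obtain x where x: "x \<in> \<Omega>" using ne by blast
  define M where "M = measure lebesgue \<Omega>"
  have M: "M \<ge> 0" by (simp add: M_def)
  \<comment> \<open>For this radius \<open>\<theta> * r = M + \<theta>\<close> exceeds the supposed
    volume \<open>M\<close>.\<close>
  define r where "r = M / \<theta> + 1"
  have r: "r \<ge> 1" using M \<theta> by (simp add: r_def)
  have "\<theta> * r \<le> \<theta> * r ^ DIM('a)" using \<theta> r by (intro mult_left_mono self_le_power) auto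
  also have "\<dots> \<le> measure lebesgue (ball x r \<inter> \<Omega>)" using reg[OF x, of r] r by auto
  also have "\<dots> \<le> M" unfolding M_def by (rule measure_mono_fmeasurable[OF _ _ fm]) (use \<Omega> in auto)
  finally show False using \<theta> by (simp add: r_def distrib_left)
qed

text \<open>The median is the infimum of the points whose open upper tail has at most half of the
  mass. Points right of it have this property and points left of it fail it; continuity from below
  transfers both facts to the open half-lines at the infimum.\<close>

lemma median_exists:
  fixes N :: "real measure"
  assumes "finite_measure N" and sets: "sets N = sets borel"
  obtains m where "2 * measure N {m<..} \<le> measure N UNIV" "2 * measure N {..<m} \<le> measure N UNIV"
proof -
  interpret finite_measure N by fact
  have space: "space N = UNIV" using sets_eq_imp_space_eq[OF sets] by simp
  define V where "V = measure N UNIV"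
  have le_V: "measure N X \<le> V" for X
    unfolding V_def using bounded_measure[of X] by (simp add: space)
  define G where "G t = measure N {t<..}" for t
  have G_mono: "G t \<le> G s" if "s \<le> t" for s t
    unfolding G_def using that by (intro finite_measure_mono) (simp_all add: sets)
  show thesis
  \<comment> \<open>For zero mass the set \<open>S\<close> used below would be the whole line, which
    has no infimum.\<close>
  proof (cases "V = 0")
    case True
    then have "2 * measure N X \<le> measure N UNIV" for X
      using le_V[of X] measure_nonneg[of N X] unfolding V_def by linarith
    note z = this
    show thesis by (rule that[of 0]) (rule z)+
  next
    case False
    then have V: "V > 0" using measure_nonneg[of N UNIV] unfolding V_def by linarith
    define S where "S = {t. 2 * G t \<le> V}"
    have "(\<lambda>i. measure N {real i<..}) \<longlonglongrightarrow> measure N (\<Inter>i. {real i<..})"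
      by (rule finite_Lim_measure_decseq)
        (simp_all add: sets image_subset_iff decseq_def)
    moreover have "(\<Inter>i. {real i<..}) = {}"
    proof (rule equals0I)
      fix x assume x: "x \<in> (\<Inter>i. {real i<..})"
      obtain i :: nat where "x \<le> real i" using real_arch_simple by blast
      moreover have "real i < x" using INT_D[OF x UNIV_I, of i] by simp
      ultimately show False by simp
    qed
    ultimately have "(\<lambda>i. G (real i)) \<longlonglongrightarrow> 0" unfolding G_def by (simp only: measure_empty)
    then have "eventually (\<lambda>i. G (real i) < V / 2) sequentially"
      by (rule order_tendstoD(2)) (simp add: V)
    then obtain i0 where "G (real i0) < V / 2" unfolding eventually_sequentially by blast
    then have ne: "real i0 \<in> S" by (simp add: S_def)
    have "(\<lambda>i. measure N {- real i<..}) \<longlonglongrightarrow> measure N (\<Union>i. {- real i<..})"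
      by (rule finite_Lim_measure_incseq) (simp_all add: sets image_subset_iff incseq_def)
    moreover have "(\<Union>i. {- real i<..}) = UNIV"
    proof (intro set_eqI iffI UNIV_I)
      fix x :: real
      obtain i :: nat where "- x < real i" using reals_Archimedean2 by blast
      then have "x \<in> {- real i<..}" by simp
      then show "x \<in> (\<Union>i. {- real i<..})" by (rule UN_I[OF UNIV_I])
    qed
    ultimately have "(\<lambda>i. G (- real i)) \<longlonglongrightarrow> V" unfolding G_def V_def by (simp only:)
    then have "eventually (\<lambda>i. G (- real i) > V / 2) sequentially"
      by (rule order_tendstoD(1)) (simp add: V)
    then obtain i1 where i1: "G (- real i1) > V / 2" unfolding eventually_sequentially by blast
    have below: "- real i1 \<le> t" if "t \<in> S" for t
    proof (rule ccontr)
      assume "\<not> - real i1 \<le> t"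
      then have "G (- real i1) \<le> G t" by (intro G_mono) simp
      moreover have "2 * G t \<le> V" using that by (simp add: S_def)
      ultimately show False using i1 by linarith
    qed
    have bdd: "bdd_below S" using below by (rule bdd_belowI)
    define m where "m = Inf S"
    have up: "t \<in> S" if "t > m" for t
    proof -
      have "S \<noteq> {}" using ne by blast
      moreover have "Inf S < t" using that by (simp only: m_def)
      ultimately obtain s where s: "s \<in> S" "s < t" using cInf_lessD[of S t] by metis
      have "G t \<le> G s" using s by (intro G_mono) simp
      then show ?thesis using s(1) by (simp add: S_def)
    qed
    have down: "t \<notin> S" if "t < m" for t
    proof
      assume "t \<in> S"
      from cInf_lower[OF this bdd] that show False by (simp add: m_def)
    qed
    define e where "e i = 1 / real (Suc i)" for i
    have e_pos: "e i > 0" for i by (simp add: e_def)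
    have e_dec: "e (Suc i) \<le> e i" for i
      unfolding e_def by (rule divide_left_mono) simp_all
    have e_small: "\<exists>i. e i < d" if "d > 0" for d
      using reals_Archimedean[OF that] by (simp add: e_def inverse_eq_divide)
    have sets_gt: "range (\<lambda>i. {f i<..}) \<subseteq> sets N" "range (\<lambda>i. {..<f i}) \<subseteq> sets N" for f :: "nat \<Rightarrow> real"
      unfolding sets by (simp_all only: image_subset_iff borel_open[OF open_greaterThan] borel_open[OF open_lessThan]) simp_all
    show thesis
    proof (rule that)
      have "incseq (\<lambda>i. {m + e i<..})"
      proof (rule incseq_SucI)
        show "{m + e i<..} \<subseteq> {m + e (Suc i)<..}" for i
          unfolding greaterThan_subset_iff by (rule add_left_mono[OF e_dec])
      qed
      from finite_Lim_measure_incseq[OF sets_gt(1) this]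
      have "(\<lambda>i. G (m + e i)) \<longlonglongrightarrow> measure N (\<Union>i. {m + e i<..})" unfolding G_def .
      also have "(\<Union>i. {m + e i<..}) = {m<..}"
      proof (intro set_eqI iffI)
        fix x assume "x \<in> {m<..}"
        then have "x - m > 0" by simp
        from e_small[OF this] obtain i where "e i < x - m" by blast
        then have "x \<in> {m + e i<..}" unfolding greaterThan_iff by linarith
        then show "x \<in> (\<Union>i. {m + e i<..})" by (rule UN_I[OF UNIV_I])
      next
        fix x assume "x \<in> (\<Union>i. {m + e i<..})"
        then obtain i where "m + e i < x" by (auto simp only: UN_iff greaterThan_iff)
        then show "x \<in> {m<..}" using e_pos[of i] unfolding greaterThan_iff by linarith
      qed
      finally have "(\<lambda>i. 2 * G (m + e i)) \<longlonglongrightarrow> 2 * measure N {m<..}" by (rule tendsto_mult_left)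
      moreover have "2 * G (m + e i) \<le> V" for i
      proof -
        have "m + e i \<in> S" using e_pos[of i] by (intro up) simp
        then show ?thesis unfolding S_def by simp
      qed
      ultimately show "2 * measure N {m<..} \<le> measure N UNIV"
        unfolding V_def by (intro LIMSEQ_le_const2[where X="\<lambda>i. 2 * G (m + e i)"]) blast+
      have "incseq (\<lambda>i. {..<m - e i})"
      proof (rule incseq_SucI)
        show "{..<m - e i} \<subseteq> {..<m - e (Suc i)}" for i
          unfolding lessThan_subset_iff by (rule diff_left_mono[OF e_dec])
      qed
      from finite_Lim_measure_incseq[OF sets_gt(2) this]
      have "(\<lambda>i. measure N {..<m - e i}) \<longlonglongrightarrow> measure N (\<Union>i. {..<m - e i})" .
      also have "(\<Union>i. {..<m - e i}) = {..<m}"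
      proof (intro set_eqI iffI)
        fix x assume "x \<in> {..<m}"
        then have "m - x > 0" by simp
        from e_small[OF this] obtain i where "e i < m - x" by blast
        then have "x \<in> {..<m - e i}" unfolding lessThan_iff by linarith
        then show "x \<in> (\<Union>i. {..<m - e i})" by (rule UN_I[OF UNIV_I])
      next
        fix x assume "x \<in> (\<Union>i. {..<m - e i})"
        then obtain i where "x < m - e i" by (auto simp only: UN_iff lessThan_iff)
        then show "x \<in> {..<m}" using e_pos[of i] unfolding lessThan_iff by linarith
      qed
      finally have "(\<lambda>i. 2 * measure N {..<m - e i}) \<longlonglongrightarrow> 2 * measure N {..<m}" by (rule tendsto_mult_left)
      moreover have "2 * measure N {..<m - e i} \<le> V" for i
      proof -
        have "m - e i \<notin> S" using e_pos[of i] by (intro down) simp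
        then have "V < 2 * G (m - e i)" unfolding S_def by simp
        moreover have "measure N {..<m - e i} + G (m - e i) = measure N ({..<m - e i} \<union> {m - e i<..})"
          unfolding G_def by (rule finite_measure_Union[symmetric]) (auto simp add: sets)
        ultimately show ?thesis using le_V[of "{..<m - e i} \<union> {m - e i<..}"] by linarith
      qed
      ultimately show "2 * measure N {..<m} \<le> measure N UNIV"
        unfolding V_def by (intro LIMSEQ_le_const2[where X="\<lambda>i. 2 * measure N {..<m - e i}"]) blast+
    qed
  qed
qed

section \<open>The two embeddings\<close>

lemma regular_imp_embedding_unbounded:
  fixes \<Omega> :: "'a::euclidean_space set"
  assumes phi: "young_function phi" and \<alpha>: "\<alpha> < 0"
    and up: "upper_Lambda DIM('a) phi \<alpha> < \<infinity>"
    and dom: "is_domain \<Omega>" and reg: "globally_regular \<Omega>" and nb: "\<not> bounded \<Omega>"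
  obtains C where "C \<ge> 1"
    "\<And>u. u \<in> besov_space \<alpha> phi \<Omega> \<Longrightarrow> bounded {x\<in>\<Omega>. u x \<noteq> 0} \<Longrightarrow>
       Lp_norm (real DIM('a) / \<bar>\<alpha>\<bar>) \<Omega> u \<le> ennreal (C * besov_norm \<alpha> phi \<Omega> u)"
proof -
  define q where "q = real DIM('a) / (- \<alpha>)"
  have q: "q > 0" using \<alpha> unfolding q_def by (intro divide_pos_pos) auto
  have q_abs: "real DIM('a) / \<bar>\<alpha>\<bar> = q" using \<alpha> by (simp add: q_def)
  have \<Omega> [measurable]: "\<Omega> \<in> sets lebesgue" and ne: "\<Omega> \<noteq> {}" using dom by (auto simp: is_domain_def)
  obtain \<theta> where \<theta>: "0 < \<theta>" "\<theta> < 1" and reg': "\<And>x r. x \<in> \<Omega> \<Longrightarrow> r > 0 \<Longrightarrow>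
      ennreal (\<theta> * r ^ DIM('a)) \<le> emeasure lebesgue \<Omega> \<Longrightarrow> \<theta> * r ^ DIM('a) \<le> measure lebesgue (ball x r \<inter> \<Omega>)"
    using globally_regular_all_radii[OF reg] by blast
  have inf: "emeasure lebesgue \<Omega> = \<infinity>"
    by (rule globally_regular_unbounded_measure[OF reg nb ne \<Omega>])
  obtain C0 where C0: "C0 > 0" and bound:
    "\<And>u v lam. \<lbrakk>v \<in> borel_measurable lebesgue; \<And>x. x \<in> \<Omega> \<Longrightarrow> 0 \<le> v x;
       emeasure lebesgue {x\<in>\<Omega>. v x > 0} < \<infinity>;
       2 * emeasure lebesgue {x\<in>\<Omega>. v x > 0} \<le> emeasure lebesgue \<Omega>;
       lam > 0; besov_modular \<alpha> phi \<Omega> u lam \<le> 1;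
       \<And>x y. x \<in> \<Omega> \<Longrightarrow> y \<in> \<Omega> \<Longrightarrow> \<bar>v x - v y\<bar> \<le> \<bar>u x - u y\<bar> / lam\<rbrakk>
     \<Longrightarrow> (\<integral>\<^sup>+ x\<in>\<Omega>. ennreal (v x powr (real DIM('a) / (- \<alpha>))) \<partial>lebesgue) \<le> ennreal C0"
    using regular_Lp_bound[OF phi \<alpha> up \<theta> reg' \<Omega>] by blast
  define C where "C = max 1 (C0 powr (1 / q))"
  have C1: "C \<ge> 1" by (simp add: C_def)
  show thesis
  proof
    show "C \<ge> 1" by (fact C1)
    fix u assume u: "u \<in> besov_space \<alpha> phi \<Omega>" and bs: "bounded {x\<in>\<Omega>. u x \<noteq> 0}"
    show "Lp_norm (real DIM('a) / \<bar>\<alpha>\<bar>) \<Omega> u \<le> ennreal (C * besov_norm \<alpha> phi \<Omega> u)"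
      unfolding q_abs
    proof (rule le_besov_normI[OF u])
      show "C > 0" using C1 by simp
      fix lam assume "lam \<in> besov_admissible \<alpha> phi \<Omega> u"
      then have lam: "lam > 0" and mod1: "besov_modular \<alpha> phi \<Omega> u lam \<le> 1"
        by (auto simp: besov_admissible_def)
      \<comment> \<open>Membership in the Besov space gives measurability on \<Omega> only, whereas
        \<open>regular_Lp_bound\<close> wants a function measurable on the whole space; hence the
        extension by zero.\<close>
      define w where "w x = indicat_real \<Omega> x *\<^sub>R u x" for x
      have w [measurable]: "w \<in> borel_measurable lebesgue"
        using u \<Omega> unfolding besov_space_def w_def
        by (simp add: borel_measurable_restrict_space_iff)
      \<comment> \<open>Normalizing by \<open>lam\<close> makes the bound \<open>C0\<close>
        absolute; the factor \<open>lam powr q\<close> is restored at the end.\<close>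
      define v where "v x = \<bar>w x\<bar> / lam" for x
      have v [measurable]: "v \<in> borel_measurable lebesgue" unfolding v_def using w by measurable
      have v_eq: "v x = \<bar>u x\<bar> / lam" if "x \<in> \<Omega>" for x using that by (simp add: v_def w_def)
      obtain a where a: "{x\<in>\<Omega>. u x \<noteq> 0} \<subseteq> ball 0 a"
        using bounded_subset_ballD[OF bs, of 0] by blast
      have "{x\<in>\<Omega>. v x > 0} \<subseteq> ball 0 a"
      proof
        fix x assume "x \<in> {x\<in>\<Omega>. v x > 0}"
        then have "x \<in> \<Omega>" "u x \<noteq> 0" using v_eq[of x] by auto
        then show "x \<in> ball 0 a" using a by blast
      qed
      then have "emeasure lebesgue {x\<in>\<Omega>. v x > 0} \<le> emeasure lebesgue (ball (0::'a) a)"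
        by (rule emeasure_mono) simp
      also have "\<dots> < \<infinity>" using emeasure_bounded_finite[of "ball (0::'a) a"] by simp
      finally have fin: "emeasure lebesgue {x\<in>\<Omega>. v x > 0} < \<infinity>" .
      have I: "(\<integral>\<^sup>+ x\<in>\<Omega>. ennreal (v x powr q) \<partial>lebesgue) \<le> ennreal C0"
        unfolding q_def
      proof (rule bound[OF v _ fin _ lam mod1])
        show "0 \<le> v x" for x using lam by (simp add: v_def)
        show "2 * emeasure lebesgue {x\<in>\<Omega>. v x > 0} \<le> emeasure lebesgue \<Omega>" unfolding inf by simp
        fix x y assume "x \<in> \<Omega>" "y \<in> \<Omega>"
        then have "\<bar>v x - v y\<bar> = \<bar>\<bar>u x\<bar> - \<bar>u y\<bar>\<bar> / lam"
          using lam by (simp add: v_eq diff_divide_distrib[symmetric] abs_divide)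
        also have "\<dots> \<le> \<bar>u x - u y\<bar> / lam" using lam by (intro divide_right_mono) auto
        finally show "\<bar>v x - v y\<bar> \<le> \<bar>u x - u y\<bar> / lam" .
      qed
      show "Lp_norm q \<Omega> u \<le> ennreal (C * lam)"
      proof (rule Lp_norm_le[OF q])
        show "0 \<le> C * lam" using C1 lam by simp
        have "(\<integral>\<^sup>+ x\<in>\<Omega>. ennreal (\<bar>u x\<bar> powr q) \<partial>lebesgue)
           = (\<integral>\<^sup>+ x. ennreal (lam powr q) * (ennreal (v x powr q) * indicator \<Omega> x) \<partial>lebesgue)"
        proof (intro nn_integral_cong)
          fix x
          show "ennreal (\<bar>u x\<bar> powr q) * indicator \<Omega> x = ennreal (lam powr q) * (ennreal (v x powr q) * indicator \<Omega> x)"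
          proof (cases "x \<in> \<Omega>")
            case True
            then have "\<bar>u x\<bar> powr q = lam powr q * v x powr q"
              using lam by (simp add: v_eq powr_divide)
            then show ?thesis using True by (simp add: ennreal_mult)
          qed simp
        qed
        also have "\<dots> = ennreal (lam powr q) * (\<integral>\<^sup>+ x\<in>\<Omega>. ennreal (v x powr q) \<partial>lebesgue)"
          by (rule nn_integral_cmult) measurable
        also have "\<dots> \<le> ennreal (lam powr q) * ennreal C0" using I by (intro mult_left_mono) auto
        also have "\<dots> = ennreal (C0 * lam powr q)" using C0 by (simp add: ennreal_mult mult.commute)
        also have "\<dots> \<le> ennreal ((C * lam) powr q)"
        proof (rule ennreal_leI)
          have "C0 = (C0 powr (1 / q)) powr q" using C0 q by (simp add: powr_powr)
          also have "\<dots> \<le> C powr q" using q by (intro powr_mono2) (auto simp: C_def)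
          finally have "C0 * lam powr q \<le> C powr q * lam powr q" by (intro mult_right_mono) auto
          then show "C0 * lam powr q \<le> (C * lam) powr q" using C1 lam by (simp add: powr_mult)
        qed
        finally show "(\<integral>\<^sup>+ x\<in>\<Omega>. ennreal (\<bar>u x\<bar> powr q) \<partial>lebesgue) \<le> ennreal ((C * lam) powr q)" .
      qed
    qed
  qed
qed

text \<open>Each of the two parts of \<open>u\<close> minus a median is positive on at most half of
  \<Omega>, so the core bound applies to both. The average is then compared with the median: their
  distance is at most the mean of the absolute difference, which the power integral controls because
  \<open>q > 1\<close>.\<close>

lemma regular_imp_embedding_bounded:
  fixes \<Omega> :: "'a::euclidean_space set"
  assumes phi: "young_function phi" and \<alpha>: "- real DIM('a) < \<alpha>" "\<alpha> < 0"
    and up: "upper_Lambda DIM('a) phi \<alpha> < \<infinity>"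
    and dom: "is_domain \<Omega>" and reg: "globally_regular \<Omega>" and bd: "bounded \<Omega>"
  obtains C where "C \<ge> 1"
    "\<And>u. u \<in> besov_space \<alpha> phi \<Omega> \<Longrightarrow>
       Lp_norm (real DIM('a) / \<bar>\<alpha>\<bar>) \<Omega> (\<lambda>x. u x - average \<Omega> u) \<le> ennreal (C * besov_norm \<alpha> phi \<Omega> u)"
proof -
  define q where "q = real DIM('a) / (- \<alpha>)"
  have q1: "q > 1" unfolding q_def using \<alpha> by (subst less_divide_eq_1_pos) auto
  then have q: "q > 0" by simp
  have q_abs: "real DIM('a) / \<bar>\<alpha>\<bar> = q" using \<alpha> by (simp add: q_def)
  have op: "open \<Omega>" and ne: "\<Omega> \<noteq> {}" using dom by (auto simp: is_domain_def)
  then have \<Omega> [measurable]: "\<Omega> \<in> sets lebesgue" by auto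
  have fm: "\<Omega> \<in> lmeasurable" using bd op by (simp add: lmeasurable_open)
  define V where "V = measure lebesgue \<Omega>"
  have V: "V > 0" unfolding V_def
    using open_not_negligible[OF op ne] fm measure_nonneg[of lebesgue \<Omega>]
    by (auto simp: negligible_iff_measure less_le)
  have eV: "emeasure lebesgue \<Omega> = ennreal V" unfolding V_def by (rule emeasure_eq_measure2[OF fm])
  obtain \<theta> where \<theta>: "0 < \<theta>" "\<theta> < 1" and reg': "\<And>x r. x \<in> \<Omega> \<Longrightarrow> r > 0 \<Longrightarrow>
      ennreal (\<theta> * r ^ DIM('a)) \<le> emeasure lebesgue \<Omega> \<Longrightarrow> \<theta> * r ^ DIM('a) \<le> measure lebesgue (ball x r \<inter> \<Omega>)"
    using globally_regular_all_radii[OF reg] by blast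
  obtain C0 where C0: "C0 > 0" and bound:
    "\<And>u v lam. \<lbrakk>v \<in> borel_measurable lebesgue; \<And>x. x \<in> \<Omega> \<Longrightarrow> 0 \<le> v x;
       emeasure lebesgue {x\<in>\<Omega>. v x > 0} < \<infinity>;
       2 * emeasure lebesgue {x\<in>\<Omega>. v x > 0} \<le> emeasure lebesgue \<Omega>;
       lam > 0; besov_modular \<alpha> phi \<Omega> u lam \<le> 1;
       \<And>x y. x \<in> \<Omega> \<Longrightarrow> y \<in> \<Omega> \<Longrightarrow> \<bar>v x - v y\<bar> \<le> \<bar>u x - u y\<bar> / lam\<rbrakk>
     \<Longrightarrow> (\<integral>\<^sup>+ x\<in>\<Omega>. ennreal (v x powr (real DIM('a) / (- \<alpha>))) \<partial>lebesgue) \<le> ennreal C0"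
    using regular_Lp_bound[OF phi \<alpha>(2) up \<theta> reg' \<Omega>] by blast
  \<comment> \<open>Bounds the distance between average and median in units of \<open>lam\<close>;
    the numerator bounds the integral of \<open>\<bar>z\<bar>\<close> through
    \<open>\<bar>z\<bar> \<le> 1 + \<bar>z\<bar> powr q\<close>.\<close>
  define D where "D = (V + 2 * C0) / V"
  have D: "D > 0" using V C0 by (simp add: D_def)
  \<comment> \<open>From \<open>\<bar>a - b\<bar> \<le> 2 * max \<bar>a\<bar> \<bar>b\<bar>\<close>:
    the variable part contributes \<open>2 * C0\<close>, the constant part
    \<open>D powr q * V\<close>.\<close>
  define C1 where "C1 = 2 powr q * (2 * C0 + D powr q * V)"
  have C1: "C1 > 0" unfolding C1_def using C0 V by (intro mult_pos_pos add_pos_nonneg) auto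
  define C where "C = max 1 (C1 powr (1 / q))"
  have C: "C \<ge> 1" by (simp add: C_def)
  show thesis
  proof
    show "C \<ge> 1" by (fact C)
    fix u assume u: "u \<in> besov_space \<alpha> phi \<Omega>"
    define w where "w x = indicat_real \<Omega> x *\<^sub>R u x" for x
    have w [measurable]: "w \<in> borel_measurable lebesgue"
      using u \<Omega> unfolding besov_space_def w_def
      by (simp add: borel_measurable_restrict_space_iff)
    have w_eq: "w x = u x" if "x \<in> \<Omega>" for x using that by (simp add: w_def)
    \<comment> \<open>The law of \<open>u\<close> on \<Omega>, whose median is a median of
      \<open>u\<close>.\<close>
    define N where "N = distr (lebesgue_on \<Omega>) borel u"
    have u_meas: "u \<in> borel_measurable (lebesgue_on \<Omega>)" using u by (simp add: besov_space_def)
    have mN: "measure N B = measure lebesgue {x\<in>\<Omega>. u x \<in> B}" if "B \<in> sets borel" for B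
    proof -
      have "measure N B = measure (lebesgue_on \<Omega>) (u -` B \<inter> \<Omega>)"
        unfolding N_def using measure_distr[OF u_meas that] by simp
      also have "\<dots> = measure lebesgue (u -` B \<inter> \<Omega>)" using \<Omega> by (intro measure_restrict_space) auto
      also have "u -` B \<inter> \<Omega> = {x\<in>\<Omega>. u x \<in> B}" by auto
      finally show ?thesis .
    qed
    have "finite_measure N" unfolding N_def
      by (intro finite_measure.finite_measure_distr[OF _ u_meas] finite_measure_lebesgue_on[OF fm])
    moreover have "sets N = sets borel" by (simp add: N_def)
    ultimately obtain m where m: "2 * measure N {m<..} \<le> measure N UNIV" "2 * measure N {..<m} \<le> measure N UNIV"
      by (rule median_exists)
    \<comment> \<open>The sign \<open>s\<close> selects the positive or the negative part, so one
      argument covers both.\<close>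
    have part: "(\<integral>\<^sup>+ x\<in>\<Omega>. ennreal (max 0 (s * (w x - m) / lam) powr q) \<partial>lebesgue) \<le> ennreal C0"
      if lam: "lam > 0" and mod1: "besov_modular \<alpha> phi \<Omega> u lam \<le> 1" and s: "s = 1 \<or> s = - 1" for lam s
      unfolding q_def
    proof (rule bound[OF _ _ _ _ lam mod1])
      define P where "P = {x\<in>\<Omega>. max 0 (s * (w x - m) / lam) > 0}"
      have P_eq: "P = {x\<in>\<Omega>. u x \<in> (if s = 1 then {m<..} else {..<m})}"
        using lam s by (auto simp: P_def w_eq less_max_iff_disj zero_less_divide_iff)
      have P_half: "2 * measure lebesgue P \<le> V"
        using m s mN[of "{m<..}"] mN[of "{..<m}"] mN[of UNIV] unfolding P_eq V_def by auto
      show v: "(\<lambda>x. max 0 (s * (w x - m) / lam)) \<in> borel_measurable lebesgue" using w by measurable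
      have "P = \<Omega> \<inter> ((\<lambda>x. max 0 (s * (w x - m) / lam)) -` {0<..} \<inter> space lebesgue)" by (auto simp: P_def)
      moreover have "(\<lambda>x. max 0 (s * (w x - m) / lam)) -` {0<..} \<inter> space lebesgue \<in> sets lebesgue"
        by (rule measurable_sets[OF v]) simp
      ultimately have "P \<in> sets lebesgue" using \<Omega> by simp
      then have Pm: "P \<in> lmeasurable" using fm by (rule fmeasurableI2[rotated 2]) (auto simp: P_def)
      then have eP: "emeasure lebesgue P = ennreal (measure lebesgue P)" by (rule emeasure_eq_measure2)
      show "emeasure lebesgue {x\<in>\<Omega>. max 0 (s * (w x - m) / lam) > 0} < \<infinity>"
        unfolding P_def[symmetric] eP by simp
      show "2 * emeasure lebesgue {x\<in>\<Omega>. max 0 (s * (w x - m) / lam) > 0} \<le> emeasure lebesgue \<Omega>"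
      proof -
        have "2 * emeasure lebesgue P = ennreal (2 * measure lebesgue P)"
          unfolding eP by (simp add: ennreal_mult)
        also have "\<dots> \<le> ennreal V" using P_half by (rule ennreal_leI)
        finally show ?thesis unfolding P_def[symmetric] eV .
      qed
      show "0 \<le> max 0 (s * (w x - m) / lam)" for x by simp
      fix x y assume xy: "x \<in> \<Omega>" "y \<in> \<Omega>"
      have "\<bar>max 0 (s * (w x - m) / lam) - max 0 (s * (w y - m) / lam)\<bar>
          \<le> \<bar>s * (w x - m) / lam - s * (w y - m) / lam\<bar>" by linarith
      also have "s * (w x - m) / lam - s * (w y - m) / lam = s * (u x - u y) / lam"
        using xy by (simp add: w_eq diff_divide_distrib[symmetric] algebra_simps)
      also have "\<bar>s * (u x - u y) / lam\<bar> = \<bar>u x - u y\<bar> / lam"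
        using lam s by (auto simp: abs_divide abs_mult)
      finally show "\<bar>max 0 (s * (w x - m) / lam) - max 0 (s * (w y - m) / lam)\<bar> \<le> \<bar>u x - u y\<bar> / lam" .
    qed
    show "Lp_norm (real DIM('a) / \<bar>\<alpha>\<bar>) \<Omega> (\<lambda>x. u x - average \<Omega> u) \<le> ennreal (C * besov_norm \<alpha> phi \<Omega> u)"
      unfolding q_abs
    proof (rule le_besov_normI[OF u])
      show "C > 0" using C by simp
      fix lam assume "lam \<in> besov_admissible \<alpha> phi \<Omega> u"
      then have lam: "lam > 0" and mod1: "besov_modular \<alpha> phi \<Omega> u lam \<le> 1"
        by (auto simp: besov_admissible_def)
      define z where "z x = (w x - m) / lam" for x
      have z_meas [measurable]: "z \<in> borel_measurable lebesgue" unfolding z_def using w by measurable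
      have Iz: "(\<integral>\<^sup>+ x\<in>\<Omega>. ennreal (\<bar>z x\<bar> powr q) \<partial>lebesgue) \<le> ennreal (2 * C0)"
      proof -
        have "(\<integral>\<^sup>+ x\<in>\<Omega>. ennreal (\<bar>z x\<bar> powr q) \<partial>lebesgue)
          \<le> (\<integral>\<^sup>+ x. ennreal (max 0 (1 * (w x - m) / lam) powr q) * indicator \<Omega> x
               + ennreal (max 0 (- 1 * (w x - m) / lam) powr q) * indicator \<Omega> x \<partial>lebesgue)"
        proof (intro nn_integral_mono)
          fix x
          have "1 * (w x - m) / lam = z x" "- 1 * (w x - m) / lam = - z x"
            unfolding z_def by (simp_all only: mult_1 mult_minus1 minus_divide_left)
          moreover have "\<bar>z x\<bar> = max 0 (z x) \<or> \<bar>z x\<bar> = max 0 (- z x)" by linarith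
          ultimately have "\<bar>z x\<bar> = max 0 (1 * (w x - m) / lam) \<or> \<bar>z x\<bar> = max 0 (- 1 * (w x - m) / lam)"
            by (simp only:)
          then have "ennreal (\<bar>z x\<bar> powr q) \<le> ennreal (max 0 (1 * (w x - m) / lam) powr q)
              + ennreal (max 0 (- 1 * (w x - m) / lam) powr q)"
            by (elim disjE) (simp_all only: add_increasing add_increasing2 zero_le order_refl)
          then show "ennreal (\<bar>z x\<bar> powr q) * indicator \<Omega> x
             \<le> ennreal (max 0 (1 * (w x - m) / lam) powr q) * indicator \<Omega> x
               + ennreal (max 0 (- 1 * (w x - m) / lam) powr q) * indicator \<Omega> x"
            by (simp only: distrib_right[symmetric] mult_right_mono zero_le)
        qed
        also have "\<dots> = (\<integral>\<^sup>+ x\<in>\<Omega>. ennreal (max 0 (1 * (w x - m) / lam) powr q) \<partial>lebesgue)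
           + (\<integral>\<^sup>+ x\<in>\<Omega>. ennreal (max 0 (- 1 * (w x - m) / lam) powr q) \<partial>lebesgue)"
          by (rule nn_integral_add) measurable
        also have "\<dots> \<le> ennreal C0 + ennreal C0"
          by (intro add_mono part[OF lam mod1]) auto
        also have "\<dots> = ennreal (2 * C0)" using C0 by (simp add: ennreal_plus[symmetric] del: ennreal_plus)
        finally show ?thesis .
      qed
      have zV: "(\<integral>\<^sup>+ x. ennreal c * indicator \<Omega> x + ennreal (\<bar>z x\<bar> powr q) * indicator \<Omega> x \<partial>lebesgue)
          \<le> ennreal (c * V + 2 * C0)" if "c \<ge> 0" for c
      proof -
        have "(\<integral>\<^sup>+ x. ennreal c * indicator \<Omega> x + ennreal (\<bar>z x\<bar> powr q) * indicator \<Omega> x \<partial>lebesgue)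
          = (\<integral>\<^sup>+ x. ennreal c * indicator \<Omega> x \<partial>lebesgue) + (\<integral>\<^sup>+ x\<in>\<Omega>. ennreal (\<bar>z x\<bar> powr q) \<partial>lebesgue)"
          by (rule nn_integral_add) measurable
        also have "(\<integral>\<^sup>+ x. ennreal c * indicator \<Omega> x \<partial>lebesgue) = ennreal (c * V)"
          using \<Omega> that V by (simp add: nn_integral_cmult_indicator eV ennreal_mult)
        also have "ennreal (c * V) + (\<integral>\<^sup>+ x\<in>\<Omega>. ennreal (\<bar>z x\<bar> powr q) \<partial>lebesgue) \<le> ennreal (c * V) + ennreal (2 * C0)"
          using Iz by (rule add_left_mono)
        also have "\<dots> = ennreal (c * V + 2 * C0)" using C0 that V by (intro ennreal_plus[symmetric]) auto
        finally show ?thesis .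
      qed
      define f where "f x = indicat_real \<Omega> x *\<^sub>R z x" for x
      have f_meas: "f \<in> borel_measurable lebesgue" unfolding f_def by measurable
      have If: "(\<integral>\<^sup>+ x. ennreal (norm (f x)) \<partial>lebesgue) \<le> ennreal (V + 2 * C0)"
      proof -
        have "(\<integral>\<^sup>+ x. ennreal (norm (f x)) \<partial>lebesgue)
          \<le> (\<integral>\<^sup>+ x. ennreal 1 * indicator \<Omega> x + ennreal (\<bar>z x\<bar> powr q) * indicator \<Omega> x \<partial>lebesgue)"
        proof (intro nn_integral_mono)
          fix x
          have "\<bar>z x\<bar> \<le> 1 + \<bar>z x\<bar> powr q"
          proof (cases "\<bar>z x\<bar> \<le> 1")
            case False
            then have "\<bar>z x\<bar> powr 1 \<le> \<bar>z x\<bar> powr q" using q1 by (intro powr_mono) auto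
            then show ?thesis using False by simp
          qed (simp add: add_increasing2)
          then have "ennreal \<bar>z x\<bar> \<le> ennreal (1 + \<bar>z x\<bar> powr q)" by (rule ennreal_leI)
          then show "ennreal (norm (f x)) \<le> ennreal 1 * indicator \<Omega> x + ennreal (\<bar>z x\<bar> powr q) * indicator \<Omega> x"
            by (cases "x \<in> \<Omega>") (simp_all add: f_def)
        qed
        also have "\<dots> \<le> ennreal (1 * V + 2 * C0)" by (rule zV) simp
        finally show ?thesis by simp
      qed
      \<comment> \<open>Integrability ensures that \<open>average\<close> is the true mean and not
        the default value 0 of the Bochner integral.\<close>
      have f_int: "integrable lebesgue f"
        by (rule integrableI_bounded[OF f_meas le_less_trans[OF If]]) simp
      define A where "A = average \<Omega> u"
      have A_eq: "A = m + lam * (integral\<^sup>L lebesgue f / V)"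
      proof -
        have "(LINT x:\<Omega>|lebesgue. u x) = (\<integral>x. lam * f x + m * indicat_real \<Omega> x \<partial>lebesgue)"
          unfolding set_lebesgue_integral_def
          using lam by (intro Bochner_Integration.integral_cong refl) (simp add: f_def z_def w_def indicator_def)
        also have "\<dots> = lam * integral\<^sup>L lebesgue f + m * V"
          using f_int fm by (subst Bochner_Integration.integral_add) (simp_all add: V_def fmeasurable_def)
        finally show ?thesis using V by (simp add: A_def average_def V_def[symmetric] field_simps)
      qed
      have "ennreal \<bar>integral\<^sup>L lebesgue f\<bar> \<le> ennreal (V + 2 * C0)"
        using order_trans[OF integral_norm_bound_ennreal[OF f_int] If] by simp
      then have "\<bar>integral\<^sup>L lebesgue f\<bar> \<le> V + 2 * C0"
        using V C0 by (subst (asm) ennreal_le_iff) auto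
      then have AD: "\<bar>integral\<^sup>L lebesgue f / V\<bar> \<le> D" using V by (simp add: D_def abs_divide divide_right_mono)
      show "Lp_norm q \<Omega> (\<lambda>x. u x - average \<Omega> u) \<le> ennreal (C * lam)"
        unfolding A_def[symmetric]
      proof (rule Lp_norm_le[OF q])
        show "0 \<le> C * lam" using C lam by simp
        have "(\<integral>\<^sup>+ x\<in>\<Omega>. ennreal (\<bar>u x - A\<bar> powr q) \<partial>lebesgue)
           \<le> (\<integral>\<^sup>+ x. ennreal ((2 * lam) powr q) *
                (ennreal (D powr q) * indicator \<Omega> x + ennreal (\<bar>z x\<bar> powr q) * indicator \<Omega> x) \<partial>lebesgue)"
        proof (intro nn_integral_mono)
          fix x
          show "ennreal (\<bar>u x - A\<bar> powr q) * indicator \<Omega> x \<le> ennreal ((2 * lam) powr q) *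
                (ennreal (D powr q) * indicator \<Omega> x + ennreal (\<bar>z x\<bar> powr q) * indicator \<Omega> x)"
          proof (cases "x \<in> \<Omega>")
            case True
            have "lam * z x = u x - m" using True lam by (simp add: z_def w_eq)
            then have "u x - A = lam * (z x - integral\<^sup>L lebesgue f / V)"
              unfolding A_eq right_diff_distrib by linarith
            then have "\<bar>u x - A\<bar> = lam * \<bar>z x - integral\<^sup>L lebesgue f / V\<bar>"
              using lam by (simp add: abs_mult)
            also have "\<dots> \<le> lam * (2 * max D \<bar>z x\<bar>)"
              using AD lam by (intro mult_left_mono) linarith+
            finally have "\<bar>u x - A\<bar> powr q \<le> (2 * lam * max D \<bar>z x\<bar>) powr q"
              using q by (intro powr_mono2) (auto simp: mult_ac)
            also have "\<dots> = (2 * lam) powr q * max D \<bar>z x\<bar> powr q"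
              by (rule powr_mult)
            also have "\<dots> \<le> (2 * lam) powr q * (D powr q + \<bar>z x\<bar> powr q)"
              by (intro mult_left_mono) (auto simp: max_def)
            finally have "ennreal (\<bar>u x - A\<bar> powr q) \<le> ennreal ((2 * lam) powr q * (D powr q + \<bar>z x\<bar> powr q))"
              by (rule ennreal_leI)
            then show ?thesis using True by (simp add: ennreal_mult ennreal_plus)
          qed simp
        qed
        also have "\<dots> = ennreal ((2 * lam) powr q) *
            (\<integral>\<^sup>+ x. ennreal (D powr q) * indicator \<Omega> x + ennreal (\<bar>z x\<bar> powr q) * indicator \<Omega> x \<partial>lebesgue)"
          by (rule nn_integral_cmult) measurable
        also have "\<dots> \<le> ennreal ((2 * lam) powr q) * ennreal (D powr q * V + 2 * C0)"
          by (intro mult_left_mono zV) auto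
        also have "\<dots> = ennreal (C1 * lam powr q)"
        proof -
          have "(2 * lam) powr q * (D powr q * V + 2 * C0) = C1 * lam powr q"
            by (simp add: C1_def powr_mult algebra_simps)
          then show ?thesis by (simp only: ennreal_mult'[OF powr_ge_zero, symmetric])
        qed
        also have "\<dots> \<le> ennreal ((C * lam) powr q)"
        proof (rule ennreal_leI)
          have "C1 = (C1 powr (1 / q)) powr q" using C1 q by (simp add: powr_powr)
          also have "\<dots> \<le> C powr q" using q by (intro powr_mono2) (auto simp: C_def)
          finally have "C1 * lam powr q \<le> C powr q * lam powr q" by (intro mult_right_mono) auto
          then show "C1 * lam powr q \<le> (C * lam) powr q" using C lam by (simp add: powr_mult)
        qed
        finally show "(\<integral>\<^sup>+ x\<in>\<Omega>. ennreal (\<bar>u x - A\<bar> powr q) \<partial>lebesgue) \<le> ennreal ((C * lam) powr q)" .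
      qed
    qed
  qed
qed

section \<open>Cutoff functions\<close>

text \<open>Polar coordinates for radial functions: preimages of half-lines under the norm are
  closed balls, whose volume is the primitive of the density, and half-lines form an
  intersection-stable generator.\<close>

lemma distr_norm_lborel:
  "distr (lborel :: 'a::euclidean_space measure) borel norm =
   density lborel (\<lambda>s::real. ennreal (real DIM('a) * unit_ball_vol DIM('a) * s ^ (DIM('a) - 1)) * indicator {0..} s)"
  (is "?M = ?N")
proof (rule measure_eqI_generator_eq[where E="range atMost" and \<Omega>=UNIV and A="\<lambda>i::nat. {..real i}"])
  let ?n = "DIM('a)" and ?w = "unit_ball_vol (real DIM('a))"
  show "Int_stable (range (atMost :: real \<Rightarrow> real set))"
    by (auto simp: Int_stable_def)
  have sets_borel: "sets borel = sigma_sets UNIV (range (atMost :: real \<Rightarrow> real set))"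
    by (subst borel_eq_atMost) simp
  show "sets ?M = sigma_sets UNIV (range atMost)" "sets ?N = sigma_sets UNIV (range atMost)"
    using sets_borel by simp_all
  have M: "emeasure ?M {..b} = (if b \<ge> 0 then ennreal (?w * b ^ ?n) else 0)" for b
  proof -
    have "emeasure ?M {..b} = emeasure lborel (cball (0::'a) b)"
      by (subst emeasure_distr) (auto intro!: arg_cong[where f="emeasure lborel"] simp: cball_def)
    also have "\<dots> = (if b \<ge> 0 then ennreal (?w * b ^ ?n) else 0)"
      by (simp add: emeasure_cball)
    finally show ?thesis .
  qed
  show "emeasure ?M {..real i} \<noteq> \<infinity>" for i unfolding M by simp
  show "(\<Union>i::nat. {..real i}) = UNIV"
    using real_arch_simple by auto
  fix X :: "real set" assume "X \<in> range atMost"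
  then obtain b where X: "X = {..b}" by auto
  have "emeasure ?N {..b} = (\<integral>\<^sup>+ s. ennreal (real ?n * ?w * s ^ (?n - 1)) * indicator {0..b} s \<partial>lborel)"
    by (subst emeasure_density) (auto intro!: nn_integral_cong simp: indicator_def)
  also have "\<dots> = (if b \<ge> 0 then ennreal (?w * b ^ ?n) else 0)"
  proof (cases "b \<ge> 0")
    case True
    have "(\<integral>\<^sup>+ s. ennreal (real ?n * ?w * s ^ (?n - 1)) * indicator {0..b} s \<partial>lborel)
      = ennreal (?w * b ^ ?n - ?w * 0 ^ ?n)"
    proof (rule nn_integral_FTC_Icc)
      fix s :: real assume "s \<in> {0..b}"
      show "((\<lambda>s. ?w * s ^ ?n) has_real_derivative real ?n * ?w * s ^ (?n - 1)) (at s)"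
        by (auto intro!: derivative_eq_intros)
      show "0 \<le> real ?n * ?w * s ^ (?n - 1)" using \<open>s \<in> {0..b}\<close> by simp
    qed (use True in auto)
    then show ?thesis using True by simp
  qed simp
  finally show "emeasure ?M X = emeasure ?N X" unfolding X M by simp
qed auto

lemma nn_integral_norm:
  fixes g :: "real \<Rightarrow> ennreal"
  assumes [measurable]: "g \<in> borel_measurable borel"
  shows "(\<integral>\<^sup>+ y. g (norm (y::'a::euclidean_space)) \<partial>lborel) =
    (\<integral>\<^sup>+ s. ennreal (real DIM('a) * unit_ball_vol DIM('a) * s ^ (DIM('a) - 1)) * indicator {0..} s * g s \<partial>lborel)"
proof -
  have "(\<integral>\<^sup>+ y. g (norm (y::'a)) \<partial>lborel) = (\<integral>\<^sup>+ s. g s \<partial>distr (lborel :: 'a measure) borel norm)"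
    by (subst nn_integral_distr) auto
  then show ?thesis unfolding distr_norm_lborel by (simp add: nn_integral_density)
qed

text \<open>With \<open>t = s / \<delta>\<close> the radial integral splits at \<open>t = 1\<close> into the integrals
  bounded by \<open>lower_Lambda\<close> and \<open>upper_Lambda\<close>.\<close>

lemma cutoff_kernel_integral_le:
  fixes phi :: "real \<Rightarrow> real"
  assumes phi: "young_function phi" and \<delta>: "\<delta> > 0" and lam: "lam > 0"
  shows "(\<integral>\<^sup>+ y. ennreal (phi (min 1 (norm y / \<delta>) * norm y powr (- \<alpha>) / lam) / norm y ^ (2 * DIM('a)))
            \<partial>(lborel :: 'a::euclidean_space measure))
    \<le> ennreal (real DIM('a) * unit_ball_vol DIM('a) * (phi (\<delta> powr (- \<alpha>) / lam) / \<delta> ^ DIM('a)))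
        * (lower_Lambda DIM('a) phi \<alpha> + upper_Lambda DIM('a) phi \<alpha>)"
proof -
  let ?n = "DIM('a)" and ?w = "unit_ball_vol (real DIM('a))"
  define psi where "psi = (\<lambda>t. phi \<bar>t\<bar>)"
  have psi_meas [measurable]: "psi \<in> borel_measurable borel"
    unfolding psi_def by (rule young_abs_measurable[OF phi])
  \<comment> \<open>The argument of \<open>phi\<close> at distance \<delta>; dividing by
    \<open>phi X\<close> produces the integrands of both suprema at \<open>x = X\<close>.\<close>
  define X where "X = \<delta> powr (- \<alpha>) / lam"
  have X: "X > 0" using \<delta> lam by (simp add: X_def)
  have phiX: "phi X > 0" using phi X by (simp add: young_function_def)
  define c where "c = real ?n * ?w * (phi X / \<delta> ^ ?n)"
  have c: "c \<ge> 0" using phiX \<delta> by (simp add: c_def)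
  define g where "g s = ennreal (psi (min 1 (s / \<delta>) * s powr (- \<alpha>) / lam) / s ^ (2 * ?n))" for s
  have g_meas [measurable]: "g \<in> borel_measurable borel" unfolding g_def by measurable
  define f where "f s = ennreal (real ?n * ?w * s ^ (?n - 1)) * indicator {0..} s * g s" for s
  have f_meas [measurable]: "f \<in> borel_measurable borel" unfolding f_def by measurable
  define F1 where "F1 t = ennreal (phi (t powr (1 - \<alpha>) * X) / phi X / t ^ (?n + 1)) * indicator {0<..<1} t" for t
  define F2 where "F2 t = ennreal (phi (t powr (- \<alpha>) * X) / phi X / t ^ (?n + 1)) * indicator {1<..} t" for t
  have F1_eq: "F1 = (\<lambda>t. ennreal (psi (t powr (1 - \<alpha>) * X) / phi X / t ^ (?n + 1)) * indicator {0<..<1} t)"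
    using X by (simp add: F1_def psi_def fun_eq_iff)
  have F1_meas: "F1 \<in> borel_measurable lborel" unfolding F1_eq by measurable
  have F2_eq: "F2 = (\<lambda>t. ennreal (psi (t powr (- \<alpha>) * X) / phi X / t ^ (?n + 1)) * indicator {1<..} t)"
    using X by (simp add: F2_def psi_def fun_eq_iff)
  have F2_meas: "F2 \<in> borel_measurable lborel" unfolding F2_eq by measurable
  \<comment> \<open>Jacobian, sphere area and kernel combine to the weight
    \<open>1 / t ^ (n + 1)\<close>.\<close>
  have pow: "\<delta> * ((\<delta> * t) ^ (?n - 1) / (\<delta> * t) ^ (2 * ?n)) = 1 / (\<delta> ^ ?n * t ^ (?n + 1))" if "t > 0" for t
  proof -
    have "(\<delta> * t) ^ (2 * ?n) = (\<delta> * t) ^ (?n - 1) * ((\<delta> * t) ^ (?n + 1))"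
    proof -
      have "2 * ?n = (?n - 1) + (?n + 1)" using DIM_positive[where 'a='a] by linarith
      then show ?thesis by (metis power_add)
    qed
    then have "(\<delta> * t) ^ (?n - 1) / (\<delta> * t) ^ (2 * ?n) = 1 / (\<delta> * t) ^ (?n + 1)" using that \<delta> by simp
    then show ?thesis using that \<delta> by (simp add: power_mult_distrib)
  qed
  \<comment> \<open>The point 1 belongs to neither open interval; it is a null set and is discarded
    almost everywhere below.\<close>
  have pt: "ennreal \<delta> * f (\<delta> * t) \<le> ennreal c * (F1 t + F2 t)" if "t \<noteq> 1" for t
  proof (cases "t > 0")
    case False
    have "psi 0 = 0" using phi by (simp add: psi_def young_function_def)
    then have "f (\<delta> * t) = 0"
      using \<delta> False by (cases "t = 0") (auto simp: f_def g_def indicator_def mult_le_0_iff zero_le_mult_iff)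
    then show ?thesis by simp
  next
    case t: True
    define A where "A = phi (min 1 t * t powr (- \<alpha>) * X)"
    have A0: "A \<ge> 0" unfolding A_def using t X by (intro young_nonneg[OF phi]) auto
    have "f (\<delta> * t) = ennreal (real ?n * ?w * (\<delta> * t) ^ (?n - 1)) * ennreal (A / (\<delta> * t) ^ (2 * ?n))"
    proof -
      have "min 1 (\<delta> * t / \<delta>) * (\<delta> * t) powr (- \<alpha>) / lam = min 1 t * t powr (- \<alpha>) * X"
        using \<delta> by (simp add: X_def powr_mult mult_ac)
      moreover have "0 \<le> min 1 t * t powr (- \<alpha>) * X" using t X by simp
      ultimately show ?thesis using t \<delta> by (simp add: f_def g_def psi_def A_def)
    qed
    then have "ennreal \<delta> * f (\<delta> * t) = ennreal (\<delta> * (real ?n * ?w * (\<delta> * t) ^ (?n - 1) * (A / (\<delta> * t) ^ (2 * ?n))))"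
    proof -
      assume f: "f (\<delta> * t) = ennreal (real ?n * ?w * (\<delta> * t) ^ (?n - 1)) * ennreal (A / (\<delta> * t) ^ (2 * ?n))"
      have "0 \<le> real ?n * ?w * (\<delta> * t) ^ (?n - 1)" using t \<delta> by simp
      from ennreal_mult'[OF this] ennreal_mult'[OF less_imp_le[OF \<delta>]] show ?thesis
        by (simp only: f)
    qed
    also have "\<delta> * (real ?n * ?w * (\<delta> * t) ^ (?n - 1) * (A / (\<delta> * t) ^ (2 * ?n)))
       = real ?n * ?w * A * (\<delta> * ((\<delta> * t) ^ (?n - 1) / (\<delta> * t) ^ (2 * ?n)))" by simp
    also have "\<dots> = real ?n * ?w * A * (1 / (\<delta> ^ ?n * t ^ (?n + 1)))" unfolding pow[OF t] ..
    also have "\<dots> = c * (A / phi X / t ^ (?n + 1))" using phiX by (simp add: c_def)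
    also have "ennreal (c * (A / phi X / t ^ (?n + 1))) = ennreal c * ennreal (A / phi X / t ^ (?n + 1))"
      by (rule ennreal_mult'[OF c])
    also have "ennreal (A / phi X / t ^ (?n + 1)) \<le> F1 t + F2 t"
    proof (cases "t < 1")
      case True
      then have "min 1 t * t powr (- \<alpha>) = t powr (1 - \<alpha>)"
        using t by (simp add: powr_diff powr_minus divide_inverse)
      then show ?thesis using t True by (simp add: A_def F1_def F2_def)
    next
      case False
      then show ?thesis using that by (simp add: A_def F1_def F2_def)
    qed
    finally show ?thesis by (simp add: mult_left_mono)
  qed
  have "(\<integral>\<^sup>+ y. ennreal (phi (min 1 (norm y / \<delta>) * norm y powr (- \<alpha>) / lam) / norm y ^ (2 * ?n)) \<partial>(lborel :: 'a measure))
     = (\<integral>\<^sup>+ y. g (norm (y::'a)) \<partial>lborel)"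
    using \<delta> lam by (intro nn_integral_cong) (simp add: g_def psi_def)
  also have "\<dots> = (\<integral>\<^sup>+ s. f s \<partial>lborel)" unfolding f_def by (rule nn_integral_norm[OF g_meas])
  also have "\<dots> = ennreal \<delta> * (\<integral>\<^sup>+ t. f (\<delta> * t) \<partial>lborel)"
    using nn_integral_real_affine[OF f_meas, of \<delta> 0] \<delta> by simp
  also have "\<dots> = (\<integral>\<^sup>+ t. ennreal \<delta> * f (\<delta> * t) \<partial>lborel)"
    by (rule nn_integral_cmult[symmetric]) measurable
  also have "\<dots> \<le> (\<integral>\<^sup>+ t. ennreal c * (F1 t + F2 t) \<partial>lborel)"
    using AE_lborel_singleton[of "1::real"] by (intro nn_integral_mono_AE) (auto elim!: eventually_mono intro!: pt)
  also have "\<dots> = ennreal c * ((\<integral>\<^sup>+ t. F1 t \<partial>lborel) + (\<integral>\<^sup>+ t. F2 t \<partial>lborel))"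
    using F1_meas F2_meas by (simp add: nn_integral_cmult nn_integral_add)
  also have "\<dots> \<le> ennreal c * (lower_Lambda ?n phi \<alpha> + upper_Lambda ?n phi \<alpha>)"
    unfolding F1_def F2_def
    by (intro mult_left_mono add_mono lower_Lambda_bound[OF X] upper_Lambda_bound[OF X]) simp
  finally show ?thesis unfolding c_def X_def .
qed

section \<open>The cutoff and its modular\<close>

definition cutoff :: "'a::euclidean_space \<Rightarrow> real \<Rightarrow> 'a \<Rightarrow> real" where
  "cutoff x \<delta> y = max 0 (min 1 (2 - dist x y / \<delta>))"

lemma cutoff_eq_1: "\<delta> > 0 \<Longrightarrow> dist x y \<le> \<delta> \<Longrightarrow> cutoff x \<delta> y = 1"
  by (simp add: cutoff_def le_diff_eq)

lemma cutoff_eq_0: "\<delta> > 0 \<Longrightarrow> dist x y \<ge> 2 * \<delta> \<Longrightarrow> cutoff x \<delta> y = 0"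
  by (simp add: cutoff_def min_def le_divide_eq)

lemma cutoff_diff_le:
  assumes "\<delta> > 0"
  shows "\<bar>cutoff x \<delta> y - cutoff x \<delta> z\<bar> \<le> min 1 (norm (y - z) / \<delta>)"
proof -
  have "\<bar>dist x y - dist x z\<bar> \<le> norm (y - z)"
    using abs_dist_diff_le[of y x z] by (simp add: dist_commute dist_norm[symmetric])
  then have "\<bar>dist x y - dist x z\<bar> / \<delta> \<le> norm (y - z) / \<delta>" using assms by (intro divide_right_mono) auto
  moreover have "\<bar>dist x y / \<delta> - dist x z / \<delta>\<bar> = \<bar>dist x y - dist x z\<bar> / \<delta>"
    using assms by (simp add: diff_divide_distrib[symmetric] abs_divide)
  ultimately have "\<bar>dist x y / \<delta> - dist x z / \<delta>\<bar> \<le> norm (y - z) / \<delta>" by simp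
  then show ?thesis unfolding cutoff_def by linarith
qed

lemma cutoff_measurable [measurable]: "cutoff x \<delta> \<in> borel_measurable borel"
  unfolding cutoff_def by measurable

text \<open>A pair contributes only if one of its points lies in
  \<open>ball x (2 * \<delta>) \<inter> \<Omega>\<close>, which explains the factor 2. The other
  point is allowed to range over the whole space, where the kernel integral is translation
  invariant.\<close>

lemma besov_modular_cutoff_le:
  fixes \<Omega> :: "'a::euclidean_space set"
  assumes phi: "young_function phi" and \<delta>: "\<delta> > 0" and lam: "lam > 0" and \<Omega>: "open \<Omega>"
  shows "besov_modular \<alpha> phi \<Omega> (cutoff x \<delta>) lam
    \<le> 2 * emeasure lborel (ball x (2 * \<delta>) \<inter> \<Omega>) *
       (ennreal (real DIM('a) * unit_ball_vol DIM('a) * (phi (\<delta> powr (- \<alpha>) / lam) / \<delta> ^ DIM('a)))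
        * (lower_Lambda DIM('a) phi \<alpha> + upper_Lambda DIM('a) phi \<alpha>))"
proof -
  let ?n = "DIM('a)"
  define B where "B = ball x (2 * \<delta>) \<inter> \<Omega>"
  have B [measurable]: "B \<in> sets borel" unfolding B_def using \<Omega> by auto
  define psi where "psi = (\<lambda>t. phi \<bar>t\<bar>)"
  have psi_meas [measurable]: "psi \<in> borel_measurable borel"
    unfolding psi_def by (rule young_abs_measurable[OF phi])
  define k where "k h = ennreal (psi (min 1 (norm h / \<delta>) * norm h powr (- \<alpha>) / lam) / norm h ^ (2 * ?n))"
    for h :: 'a
  have k_meas [measurable]: "k \<in> borel_measurable borel" unfolding k_def by measurable
  have k_eq: "k h = ennreal (phi (min 1 (norm h / \<delta>) * norm h powr (- \<alpha>) / lam) / norm h ^ (2 * ?n))" for h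
    using \<delta> lam by (simp add: k_def psi_def)
  have k_sym: "k (z - y) = k (y - z)" for z y by (simp add: k_def norm_minus_commute)
  define G where "G = (\<integral>\<^sup>+ h. k h \<partial>lborel)"
  have shift: "(\<integral>\<^sup>+ y. k (y - z) \<partial>lborel) = G" for z
  proof -
    have "G = (\<integral>\<^sup>+ h. k h \<partial>distr lborel borel ((+) (- z)))" unfolding G_def lborel_distr_plus ..
    also have "\<dots> = (\<integral>\<^sup>+ y. k (- z + y) \<partial>lborel)" by (rule nn_integral_distr) auto
    finally show ?thesis by simp
  qed
  have pt: "ennreal (phi (\<bar>cutoff x \<delta> z - cutoff x \<delta> y\<bar> / (lam * norm (z - y) powr \<alpha>)) / norm (z - y) ^ (2 * ?n))
      \<le> indicator B z * k (z - y) + indicator B y * k (z - y)" if zy: "z \<in> \<Omega>" "y \<in> \<Omega>" for z y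
  proof (cases "z \<in> B \<or> y \<in> B")
    case False
    then have "dist x z \<ge> 2 * \<delta>" "dist x y \<ge> 2 * \<delta>" using zy by (auto simp: B_def not_less)
    then have "cutoff x \<delta> z = 0" "cutoff x \<delta> y = 0" using cutoff_eq_0[OF \<delta>] by auto
    then show ?thesis using phi by (simp add: young_function_def)
  next
    case True
    have "\<bar>cutoff x \<delta> z - cutoff x \<delta> y\<bar> / (lam * norm (z - y) powr \<alpha>)
        = \<bar>cutoff x \<delta> z - cutoff x \<delta> y\<bar> * norm (z - y) powr (- \<alpha>) / lam"
      by (simp add: powr_minus divide_inverse)
    also have "phi \<dots> \<le> phi (min 1 (norm (z - y) / \<delta>) * norm (z - y) powr (- \<alpha>) / lam)"
      using cutoff_diff_le[OF \<delta>, of x z y] lam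
      by (intro young_mono[OF phi] divide_right_mono mult_right_mono) auto
    finally have "ennreal (phi (\<bar>cutoff x \<delta> z - cutoff x \<delta> y\<bar> / (lam * norm (z - y) powr \<alpha>)) / norm (z - y) ^ (2 * ?n))
        \<le> k (z - y)"
      unfolding k_eq by (intro ennreal_leI divide_right_mono) auto
    also have "\<dots> \<le> indicator B z * k (z - y) + indicator B y * k (z - y)"
      using True by (auto simp: indicator_def)
    finally show ?thesis .
  qed
  have "besov_modular \<alpha> phi \<Omega> (cutoff x \<delta>) lam
     \<le> (\<integral>\<^sup>+ z. (\<integral>\<^sup>+ y. indicator B z * k (z - y) + indicator B y * k (z - y) \<partial>lborel) \<partial>lborel)"
    \<comment> \<open>Passing to \<open>lborel\<close> makes Tonelli available for exchanging the
      two integrals.\<close>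
    unfolding besov_modular_def nn_integral_completion
  proof (rule nn_integral_mono)
    fix z :: 'a
    have "(\<integral>\<^sup>+ y\<in>\<Omega>. ennreal (phi (\<bar>cutoff x \<delta> z - cutoff x \<delta> y\<bar> / (lam * norm (z - y) powr \<alpha>)) / norm (z - y) ^ (2 * ?n)) \<partial>lborel)
       \<le> (\<integral>\<^sup>+ y. indicator B z * k (z - y) + indicator B y * k (z - y) \<partial>lborel)" if "z \<in> \<Omega>"
      using that pt by (intro nn_integral_mono) (simp add: indicator_def)
    then show "(\<integral>\<^sup>+ y\<in>\<Omega>. ennreal (phi (\<bar>cutoff x \<delta> z - cutoff x \<delta> y\<bar> / (lam * norm (z - y) powr \<alpha>)) / norm (z - y) ^ (2 * ?n)) \<partial>lborel)
        * indicator \<Omega> z \<le> (\<integral>\<^sup>+ y. indicator B z * k (z - y) + indicator B y * k (z - y) \<partial>lborel)"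
      by (cases "z \<in> \<Omega>") auto
  qed
  also have "\<dots> = (\<integral>\<^sup>+ z. (\<integral>\<^sup>+ y. indicator B z * k (z - y) \<partial>lborel) + (\<integral>\<^sup>+ y. indicator B y * k (z - y) \<partial>lborel) \<partial>lborel)"
    by (intro nn_integral_cong nn_integral_add) measurable
  also have "\<dots> = (\<integral>\<^sup>+ z. (\<integral>\<^sup>+ y. indicator B z * k (z - y) \<partial>lborel) \<partial>lborel)
      + (\<integral>\<^sup>+ z. (\<integral>\<^sup>+ y. indicator B y * k (z - y) \<partial>lborel) \<partial>lborel)"
    by (rule nn_integral_add) measurable
  also have "(\<integral>\<^sup>+ z. (\<integral>\<^sup>+ y. indicator B y * k (z - y) \<partial>lborel) \<partial>lborel)
      = (\<integral>\<^sup>+ y. (\<integral>\<^sup>+ z. indicator B y * k (z - y) \<partial>lborel) \<partial>lborel)"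
    by (rule lborel_pair.Fubini'[symmetric]) measurable
  also have "(\<integral>\<^sup>+ y. (\<integral>\<^sup>+ z. indicator B y * k (z - y) \<partial>lborel) \<partial>lborel) = (\<integral>\<^sup>+ y. indicator B y * G \<partial>lborel)"
    by (intro nn_integral_cong) (simp add: nn_integral_cmult shift)
  also have "(\<integral>\<^sup>+ z. (\<integral>\<^sup>+ y. indicator B z * k (z - y) \<partial>lborel) \<partial>lborel) = (\<integral>\<^sup>+ y. indicator B y * G \<partial>lborel)"
    by (intro nn_integral_cong) (subst k_sym, simp add: nn_integral_cmult shift)
  also have "(\<integral>\<^sup>+ y. indicator B y * G \<partial>lborel) = emeasure lborel B * G"
    by (subst nn_integral_multc) auto
  also have "emeasure lborel B * G + emeasure lborel B * G = 2 * emeasure lborel B * G"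
    by (simp add: mult_2 distrib_right)
  also have "\<dots> \<le> 2 * emeasure lborel B *
       (ennreal (real ?n * unit_ball_vol ?n * (phi (\<delta> powr (- \<alpha>) / lam) / \<delta> ^ ?n))
        * (lower_Lambda ?n phi \<alpha> + upper_Lambda ?n phi \<alpha>))"
    unfolding G_def k_eq by (intro mult_left_mono cutoff_kernel_integral_le[OF phi \<delta> lam]) simp
  finally show ?thesis unfolding B_def .
qed

section \<open>Regularity from the embedding\<close>

lemma cutoff_in_besov_space:
  fixes \<Omega> :: "'a::euclidean_space set"
  assumes "lam > 0" "besov_modular \<alpha> phi \<Omega> (cutoff x \<delta>) lam \<le> 1"
  shows "cutoff x \<delta> \<in> besov_space \<alpha> phi \<Omega>" "besov_norm \<alpha> phi \<Omega> (cutoff x \<delta>) \<le> lam"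
proof -
  have adm: "lam \<in> besov_admissible \<alpha> phi \<Omega> (cutoff x \<delta>)"
    using assms by (simp add: besov_admissible_def)
  have "cutoff x \<delta> \<in> borel_measurable lborel" by measurable
  then have "cutoff x \<delta> \<in> borel_measurable (restrict_space lebesgue \<Omega>)"
    by (intro measurable_restrict_space1 measurable_completion)
  with adm show "cutoff x \<delta> \<in> besov_space \<alpha> phi \<Omega>" by (auto simp: besov_space_def)
  have "bdd_below (besov_admissible \<alpha> phi \<Omega> (cutoff x \<delta>))"
    by (rule bdd_belowI[of _ 0]) (simp add: besov_admissible_def)
  with adm show "besov_norm \<alpha> phi \<Omega> (cutoff x \<delta>) \<le> lam"
    unfolding besov_norm_def by (rule cInf_lower)
qed

lemma emeasure_ball_Int:
  "emeasure lebesgue (ball x r \<inter> \<Omega>) = ennreal (measure lebesgue (ball x r \<inter> \<Omega>))"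
  if "open \<Omega>" for \<Omega> :: "'a::euclidean_space set"
proof (rule emeasure_eq_measure2)
  show "ball x r \<inter> \<Omega> \<in> lmeasurable"
    using that by (intro lmeasurable_open bounded_Int) auto
qed

text \<open>The cutoff equals 1 on the smaller ball, so the integral of its power dominates the
  measure there.\<close>

lemma measure_ball_le_unbounded:
  fixes \<Omega> :: "'a::euclidean_space set"
  assumes op: "open \<Omega>" and q: "q > 0" and C: "C \<ge> 0" and \<delta>: "\<delta> > 0" and lam: "lam > 0"
    and mod1: "besov_modular \<alpha> phi \<Omega> (cutoff x \<delta>) lam \<le> 1"
    and emb: "\<And>u. u \<in> besov_space \<alpha> phi \<Omega> \<Longrightarrow> bounded {x\<in>\<Omega>. u x \<noteq> 0} \<Longrightarrow>
      Lp_norm q \<Omega> u \<le> ennreal (C * besov_norm \<alpha> phi \<Omega> u)"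
  shows "measure lebesgue (ball x \<delta> \<inter> \<Omega>) \<le> (2 * C * lam) powr q"
proof -
  have "{y\<in>\<Omega>. cutoff x \<delta> y \<noteq> 0} \<subseteq> ball x (2 * \<delta>)"
    using cutoff_eq_0[OF \<delta>, of x] by (force simp: not_le)
  then have "bounded {y\<in>\<Omega>. cutoff x \<delta> y \<noteq> 0}" using bounded_ball bounded_subset by blast
  from emb[OF cutoff_in_besov_space(1)[OF lam mod1] this]
  have "Lp_norm q \<Omega> (cutoff x \<delta>) \<le> ennreal (C * besov_norm \<alpha> phi \<Omega> (cutoff x \<delta>))" .
  also have "\<dots> \<le> ennreal (C * lam)"
    using cutoff_in_besov_space(2)[OF lam mod1] C by (intro ennreal_leI mult_left_mono)
  finally have I: "(\<integral>\<^sup>+ y\<in>\<Omega>. ennreal (\<bar>cutoff x \<delta> y\<bar> powr q) \<partial>lebesgue) \<le> ennreal ((C * lam) powr q)"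
    using C lam q by (intro integral_le_of_Lp_norm_le) auto
  have "ennreal (measure lebesgue (ball x \<delta> \<inter> \<Omega>)) = (\<integral>\<^sup>+ y. indicator (ball x \<delta> \<inter> \<Omega>) y \<partial>lebesgue)"
    unfolding emeasure_ball_Int[OF op, symmetric] using op by (intro nn_integral_indicator[symmetric]) auto
  also have "\<dots> \<le> (\<integral>\<^sup>+ y\<in>\<Omega>. ennreal (\<bar>cutoff x \<delta> y\<bar> powr q) \<partial>lebesgue)"
    using cutoff_eq_1[OF \<delta>, of x] by (intro nn_integral_mono) (auto simp: indicator_def)
  also note I
  finally have "measure lebesgue (ball x \<delta> \<inter> \<Omega>) \<le> (C * lam) powr q" by simp
  \<comment> \<open>The factor 2 gives the bound the form it has on bounded domains, so that both
    feed the same iteration.\<close>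
  also have "\<dots> \<le> (2 * C * lam) powr q" using C lam q by (intro powr_mono2) auto
  finally show ?thesis .
qed

text \<open>Half of \<open>\<Omega>\<close> lies where the cutoff vanishes, and a constant cannot be close
  to both \<open>0\<close> and \<open>1\<close>.\<close>

lemma measure_ball_le_bounded:
  fixes \<Omega> :: "'a::euclidean_space set"
  assumes op: "open \<Omega>" and bd: "bounded \<Omega>" and q: "q > 0" and C: "C \<ge> 0" and \<delta>: "\<delta> > 0" and lam: "lam > 0"
    and mod1: "besov_modular \<alpha> phi \<Omega> (cutoff x \<delta>) lam \<le> 1"
    and half: "2 * measure lebesgue (ball x (2 * \<delta>) \<inter> \<Omega>) \<le> measure lebesgue \<Omega>"
    and emb: "\<And>u. u \<in> besov_space \<alpha> phi \<Omega> \<Longrightarrow>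
      Lp_norm q \<Omega> (\<lambda>x. u x - average \<Omega> u) \<le> ennreal (C * besov_norm \<alpha> phi \<Omega> u)"
  shows "measure lebesgue (ball x \<delta> \<inter> \<Omega>) \<le> (2 * C * lam) powr q"
proof -
  let ?u = "cutoff x \<delta>"
  define c where "c = average \<Omega> ?u"
  define B1 B2 where "B1 = ball x \<delta> \<inter> \<Omega>" and "B2 = ball x (2 * \<delta>) \<inter> \<Omega>"
  have fm: "\<Omega> \<in> lmeasurable" "B1 \<in> lmeasurable" "B2 \<in> lmeasurable"
    unfolding B1_def B2_def using op bd by (auto intro!: lmeasurable_open bounded_Int)
  have B12: "B1 \<subseteq> B2" unfolding B1_def B2_def using \<delta> by auto
  have le12: "measure lebesgue B1 \<le> measure lebesgue B2"
    using B12 fm by (intro measure_mono_fmeasurable) auto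
  have "measure lebesgue (\<Omega> - B2) = measure lebesgue \<Omega> - measure lebesgue B2"
    using fm by (intro measurable_measure_Diff) (auto simp: B2_def)
  then have outer: "measure lebesgue B1 \<le> measure lebesgue (\<Omega> - B2)"
    using half le12 unfolding B2_def[symmetric] by linarith
  have Lp: "Lp_norm q \<Omega> (\<lambda>y. ?u y - c) \<le> ennreal (C * besov_norm \<alpha> phi \<Omega> ?u)"
    unfolding c_def by (rule emb[OF cutoff_in_besov_space(1)[OF lam mod1]])
  also have "\<dots> \<le> ennreal (C * lam)"
    using cutoff_in_besov_space(2)[OF lam mod1] C by (intro ennreal_leI mult_left_mono)
  finally have I: "(\<integral>\<^sup>+ y\<in>\<Omega>. ennreal (\<bar>?u y - c\<bar> powr q) \<partial>lebesgue) \<le> ennreal ((C * lam) powr q)"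
    using C lam q by (intro integral_le_of_Lp_norm_le) auto
  \<comment> \<open>If \<open>c \<le> 1/2\<close> take the small ball, where the cutoff is 1;
    otherwise take the part of \<Omega> outside the large ball, where it is 0 and which is at least
    as large by \<open>half\<close>.\<close>
  obtain S where S: "S \<in> lmeasurable" "S \<subseteq> \<Omega>" "measure lebesgue B1 \<le> measure lebesgue S"
    "\<And>y. y \<in> S \<Longrightarrow> \<bar>?u y - c\<bar> \<ge> 1/2"
  proof (cases "c \<le> 1/2")
    case True
    show thesis
    proof (rule that[of B1])
      fix y assume "y \<in> B1"
      then have "?u y = 1" using cutoff_eq_1[OF \<delta>, of x y] by (simp add: B1_def)
      then show "\<bar>?u y - c\<bar> \<ge> 1/2" using True by simp
    qed (use fm in \<open>auto simp: B1_def\<close>)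
  next
    case False
    show thesis
    proof (rule that[of "\<Omega> - B2"])
      fix y assume "y \<in> \<Omega> - B2"
      then have "?u y = 0" using cutoff_eq_0[OF \<delta>, of x y] by (auto simp: B2_def not_less)
      then show "\<bar>?u y - c\<bar> \<ge> 1/2" using False by simp
    qed (use fm outer in auto)
  qed
  have "ennreal ((1/2) powr q * measure lebesgue S) = ennreal ((1/2) powr q) * emeasure lebesgue S"
    by (simp add: emeasure_eq_measure2[OF S(1)] ennreal_mult')
  also have "\<dots> = (\<integral>\<^sup>+ y. ennreal ((1/2) powr q) * indicator S y \<partial>lebesgue)"
    using S(1) by (intro nn_integral_cmult_indicator[symmetric]) auto
  also have "\<dots> \<le> (\<integral>\<^sup>+ y\<in>\<Omega>. ennreal (\<bar>?u y - c\<bar> powr q) \<partial>lebesgue)"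
  proof (intro nn_integral_mono)
    fix y
    show "ennreal ((1/2) powr q) * indicator S y \<le> ennreal (\<bar>?u y - c\<bar> powr q) * indicator \<Omega> y"
    proof (cases "y \<in> S")
      case True
      then have "(1/2) powr q \<le> \<bar>?u y - c\<bar> powr q" using S(4) q by (intro powr_mono2) auto
      then show ?thesis using True S(2) by (auto intro: ennreal_leI)
    qed simp
  qed
  also note I
  finally have "(1/2) powr q * measure lebesgue S \<le> (C * lam) powr q" by (subst (asm) ennreal_le_iff) auto
  then have "2 powr q * ((1/2) powr q * measure lebesgue S) \<le> 2 powr q * (C * lam) powr q"
    by (intro mult_left_mono) auto
  moreover have "2 powr q * (1/2) powr q = (1::real)" by (subst powr_mult[symmetric]) simp
  ultimately have "measure lebesgue S \<le> (2 * C * lam) powr q"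
    by (simp add: mult.assoc[symmetric] powr_mult)
  then show ?thesis using S(3) unfolding B1_def by linarith
qed

section \<open>Iteration over halved radii\<close>

text \<open>With \<open>lam = \<delta> powr (- \<alpha>) / s\<close>, smallness of
  \<open>phi s / s powr q\<close> makes the cutoff's modular at most 1, and the embedding returns
  the same density bound at half the radius. One \<epsilon> therefore survives all halvings, whereas
  the density at an interior point is eventually \<open>w\<close>.\<close>

lemma embedding_imp_regular:
  fixes \<Omega> :: "'a::euclidean_space set"
  assumes phi: "young_function phi" and \<alpha>: "\<alpha> < 0"
    and low: "lower_Lambda DIM('a) phi \<alpha> < \<infinity>" and up: "upper_Lambda DIM('a) phi \<alpha> < \<infinity>"
    and dom: "is_domain \<Omega>" and C: "C \<ge> 1"
    and emb_b: "bounded \<Omega> \<Longrightarrow> (\<And>u. u \<in> besov_space \<alpha> phi \<Omega> \<Longrightarrow>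
       Lp_norm (real DIM('a) / \<bar>\<alpha>\<bar>) \<Omega> (\<lambda>x. u x - average \<Omega> u) \<le> ennreal (C * besov_norm \<alpha> phi \<Omega> u))"
    and emb_u: "\<not> bounded \<Omega> \<Longrightarrow> (\<And>u. u \<in> besov_space \<alpha> phi \<Omega> \<Longrightarrow> bounded {x\<in>\<Omega>. u x \<noteq> 0} \<Longrightarrow>
       Lp_norm (real DIM('a) / \<bar>\<alpha>\<bar>) \<Omega> u \<le> ennreal (C * besov_norm \<alpha> phi \<Omega> u))"
  shows "globally_regular \<Omega>"
proof -
  let ?n = "DIM('a)"
  define q where "q = real ?n / (- \<alpha>)"
  have q: "q > 0" using \<alpha> unfolding q_def by (intro divide_pos_pos) auto
  have q_abs: "real ?n / \<bar>\<alpha>\<bar> = q" using \<alpha> by (simp add: q_def)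
  have op: "open \<Omega>" and ne: "\<Omega> \<noteq> {}" using dom by (auto simp: is_domain_def)
  define w where "w = unit_ball_vol (real ?n)"
  have w: "w > 0" by (simp add: w_def)
  define m where "m x r = measure lebesgue (ball x r \<inter> \<Omega>)" for x r
  define L where "L = enn2real (lower_Lambda ?n phi \<alpha> + upper_Lambda ?n phi \<alpha>)"
  have L: "lower_Lambda ?n phi \<alpha> + upper_Lambda ?n phi \<alpha> = ennreal L" "L \<ge> 0"
    using low up by (simp_all add: L_def)
  define C1 where "C1 = 2 * real ?n * w * L + 1"
  have C1: "C1 > 0" unfolding C1_def using w L by (intro add_nonneg_pos) auto
  have modular: "besov_modular \<alpha> phi \<Omega> (cutoff x \<delta>) lam \<le> ennreal (C1 * (m x (2 * \<delta>) * (phi (\<delta> powr (- \<alpha>) / lam) / \<delta> ^ ?n)))"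
    if \<delta>: "\<delta> > 0" and lam: "lam > 0" for x \<delta> lam
  proof -
    define E where "E = phi (\<delta> powr (- \<alpha>) / lam) / \<delta> ^ ?n"
    have E: "E \<ge> 0" unfolding E_def using \<delta> lam by (intro divide_nonneg_pos young_nonneg[OF phi]) auto
    have m0: "m x (2 * \<delta>) \<ge> 0" by (simp add: m_def)
    have "emeasure lborel (ball x (2 * \<delta>) \<inter> \<Omega>) = emeasure lebesgue (ball x (2 * \<delta>) \<inter> \<Omega>)"
      using op by (subst emeasure_completion) auto
    then have eB: "emeasure lborel (ball x (2 * \<delta>) \<inter> \<Omega>) = ennreal (m x (2 * \<delta>))"
      unfolding m_def emeasure_ball_Int[OF op] .
    have "besov_modular \<alpha> phi \<Omega> (cutoff x \<delta>) lam \<le> 2 * ennreal (m x (2 * \<delta>)) * (ennreal (real ?n * w * E) * ennreal L)"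
      using besov_modular_cutoff_le[OF phi \<delta> lam op, of \<alpha> x] unfolding eB L w_def[symmetric] E_def[symmetric] .
    also have "\<dots> = ennreal (2 * m x (2 * \<delta>) * (real ?n * w * E * L))"
    proof -
      have "2 * ennreal (m x (2 * \<delta>)) = ennreal (2 * m x (2 * \<delta>))" using m0 by (simp add: ennreal_mult)
      moreover have "ennreal (real ?n * w * E) * ennreal L = ennreal (real ?n * w * E * L)"
        using E w by (intro ennreal_mult'[symmetric]) auto
      ultimately show ?thesis using m0 by (simp only: ennreal_mult'[of "2 * m x (2 * \<delta>)"])
    qed
    also have "\<dots> \<le> ennreal (C1 * (m x (2 * \<delta>) * E))"
    proof (rule ennreal_leI)
      have "2 * m x (2 * \<delta>) * (real ?n * w * E * L) = (2 * real ?n * w * L) * (m x (2 * \<delta>) * E)" by simp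
      also have "\<dots> \<le> C1 * (m x (2 * \<delta>) * E)" unfolding C1_def using m0 E by (intro mult_right_mono) auto
      finally show "2 * m x (2 * \<delta>) * (real ?n * w * E * L) \<le> C1 * (m x (2 * \<delta>) * E)" .
    qed
    finally show ?thesis unfolding E_def .
  qed
  \<comment> \<open>Density below this threshold at a radius \<open>2 * \<delta>\<close> with
    \<delta> less than the diameter means at most half of \<Omega>, as the bounded case
    demands.\<close>
  define \<epsilon>1 where "\<epsilon>1 = (if bounded \<Omega> then measure lebesgue \<Omega> / (2 * (2 * diameter \<Omega>) ^ ?n) else 1)"
  have \<epsilon>1: "\<epsilon>1 > 0"
  proof (cases "bounded \<Omega>")
    case True
    obtain x e where e: "e > 0" "ball x e \<subseteq> \<Omega>" using op ne unfolding open_contains_ball by blast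
    have "0 < diameter (ball x e)" using e by simp
    also have "\<dots> \<le> diameter \<Omega>" by (rule diameter_subset[OF e(2) True])
    finally have d: "diameter \<Omega> > 0" .
    have "0 < measure lebesgue (ball x e)" using e by (simp add: content_ball)
    also have "\<dots> \<le> measure lebesgue \<Omega>"
      using e op True by (intro measure_mono_fmeasurable) (auto intro: lmeasurable_open)
    finally show ?thesis using True d by (simp add: \<epsilon>1_def)
  qed (simp add: \<epsilon>1_def)
  \<comment> \<open>The second entry keeps \<epsilon> below the density of a full ball, for the
    final contradiction; the third keeps it below 1, as the definition of regularity asks.\<close>
  define \<mu> where "\<mu> = min \<epsilon>1 (min (w / 2) (1 / 2))"
  have \<mu>: "\<mu> > 0" "\<mu> \<le> \<epsilon>1" "\<mu> < w" "\<mu> < 1" using \<epsilon>1 w by (auto simp: \<mu>_def min_def)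
  \<comment> \<open>Tuned so that \<open>C1 * 2 ^ n * \<epsilon> * (\<eta> * s powr q) = 1\<close>,
    given \<open>\<epsilon> * s powr q = (2 * C) powr q\<close>.\<close>
  define \<eta> where "\<eta> = 1 / (C1 * 2 ^ ?n * (2 * C) powr q)"
  have \<eta>: "\<eta> > 0" using C1 C by (simp add: \<eta>_def)
  obtain s where s: "s \<ge> max 1 (2 * C / \<mu> powr (1 / q))" "phi s \<le> \<eta> * s powr q"
    using young_small_ratio[OF phi \<alpha> up \<eta>, of "max 1 (2 * C / \<mu> powr (1 / q))"] unfolding q_def by auto
  have s1: "s \<ge> 1" using s(1) by simp
  \<comment> \<open>The fixed point of the step: \<open>(2 * C * lam) powr q\<close> equals
    \<open>\<epsilon> * \<delta> ^ n\<close>. The lower bound on \<open>s\<close> forces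
    \<open>\<epsilon> \<le> \<mu>\<close>.\<close>
  define \<epsilon> where "\<epsilon> = (2 * C / s) powr q"
  have \<epsilon>0: "\<epsilon> > 0" using C s1 by (simp add: \<epsilon>_def)
  have \<epsilon>\<mu>: "\<epsilon> \<le> \<mu>"
  proof -
    have "2 * C / \<mu> powr (1 / q) \<le> s" using s(1) by simp
    then have "2 * C / s \<le> \<mu> powr (1 / q)" using \<mu> s1 by (simp add: field_simps)
    then have "\<epsilon> \<le> (\<mu> powr (1 / q)) powr q" unfolding \<epsilon>_def using C s1 q by (intro powr_mono2) auto
    also have "\<dots> = \<mu>" using \<mu> q by (simp add: powr_powr)
    finally show ?thesis .
  qed
  have \<epsilon>s: "\<epsilon> * s powr q = (2 * C) powr q" using s1 by (simp add: \<epsilon>_def powr_divide)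
  have step: "m x \<delta> \<le> \<epsilon> * \<delta> ^ ?n"
    if \<delta>: "\<delta> > 0" and diam: "bounded \<Omega> \<longrightarrow> \<delta> < diameter \<Omega>" and small: "m x (2 * \<delta>) \<le> \<epsilon> * (2 * \<delta>) ^ ?n" for x \<delta>
  proof -
    define lam where "lam = \<delta> powr (- \<alpha>) / s"
    have lam: "lam > 0" using \<delta> s1 by (simp add: lam_def)
    have lam_s: "\<delta> powr (- \<alpha>) / lam = s" using \<delta> s1 by (simp add: lam_def)
    have "m x (2 * \<delta>) * (phi s / \<delta> ^ ?n) \<le> \<epsilon> * (2 * \<delta>) ^ ?n * (phi s / \<delta> ^ ?n)"
      using small young_nonneg[OF phi, of s] s1 \<delta> by (intro mult_right_mono) auto
    also have "\<dots> = \<epsilon> * 2 ^ ?n * phi s" using \<delta> by (simp add: power_mult_distrib)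
    also have "\<dots> \<le> \<epsilon> * 2 ^ ?n * (\<eta> * s powr q)" using s(2) \<epsilon>0 by (intro mult_left_mono) auto
    also have "\<dots> = 2 ^ ?n * \<eta> * (\<epsilon> * s powr q)" by simp
    also have "\<dots> = 1 / C1" unfolding \<epsilon>s \<eta>_def using C C1 by simp
    finally have "C1 * (m x (2 * \<delta>) * (phi s / \<delta> ^ ?n)) \<le> 1" using C1 by (simp add: field_simps)
    then have "ennreal (C1 * (m x (2 * \<delta>) * (phi s / \<delta> ^ ?n))) \<le> 1" by (simp add: ennreal_le_1)
    with modular[OF \<delta> lam, of x] have mod1: "besov_modular \<alpha> phi \<Omega> (cutoff x \<delta>) lam \<le> 1"
      unfolding lam_s by (rule order_trans)
    have "m x \<delta> \<le> (2 * C * lam) powr q"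
    proof (cases "bounded \<Omega>")
      case True
      have "m x (2 * \<delta>) \<le> \<epsilon>1 * (2 * diameter \<Omega>) ^ ?n"
      proof -
        have "\<epsilon> * (2 * \<delta>) ^ ?n \<le> \<epsilon>1 * (2 * diameter \<Omega>) ^ ?n"
          using \<epsilon>\<mu> \<mu> \<epsilon>0 \<delta> diam True by (intro mult_mono power_mono) auto
        with small show ?thesis by linarith
      qed
      also have "\<dots> = measure lebesgue \<Omega> / 2" using True diam \<delta> by (simp add: \<epsilon>1_def)
      finally have half: "2 * measure lebesgue (ball x (2 * \<delta>) \<inter> \<Omega>) \<le> measure lebesgue \<Omega>" by (simp add: m_def)
      show ?thesis unfolding m_def
        by (rule measure_ball_le_bounded[OF op True q _ \<delta> lam mod1 half])
           (use C emb_b[OF True] in \<open>simp_all add: q_abs\<close>)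
    next
      case False
      show ?thesis unfolding m_def
        by (rule measure_ball_le_unbounded[OF op q _ \<delta> lam mod1])
           (use C emb_u[OF False] in \<open>simp_all add: q_abs\<close>)
    qed
    also have "2 * C * lam = 2 * C / s * \<delta> powr (- \<alpha>)" by (simp add: lam_def)
    also have "\<dots> powr q = \<epsilon> * \<delta> ^ ?n"
      unfolding \<epsilon>_def powr_mult[of "2 * C / s"] using \<delta> \<alpha> by (simp add: powr_powr q_def powr_realpow)
    finally show ?thesis .
  qed
  have "m x r \<ge> \<epsilon> * r ^ ?n" if x: "x \<in> \<Omega>" and r: "r > 0" and diam: "bounded \<Omega> \<longrightarrow> r < 2 * diameter \<Omega>" for x r
  proof (rule ccontr)
    assume "\<not> m x r \<ge> \<epsilon> * r ^ ?n"
    then have start: "m x r \<le> \<epsilon> * r ^ ?n" by simp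
    have iter: "m x (r / 2 ^ j) \<le> \<epsilon> * (r / 2 ^ j) ^ ?n" for j
    proof (induction j)
      case 0
      then show ?case using start by simp
    next
      case (Suc j)
      \<comment> \<open>The step is applied at the halved radius, so the restriction to radii below
        twice the diameter is what it needs.\<close>
      have "r / 2 ^ Suc j \<le> r / 2" using r by (simp add: field_simps)
      then have d: "bounded \<Omega> \<longrightarrow> r / 2 ^ Suc j < diameter \<Omega>" using diam by linarith
      have pos: "0 < r / 2 ^ Suc j" using r by simp
      have double: "2 * (r / 2 ^ Suc j) = r / 2 ^ j" by simp
      show ?case by (rule step[OF pos d]) (unfold double, rule Suc.IH)
    qed
    obtain e where e: "e > 0" "ball x e \<subseteq> \<Omega>" using op x unfolding open_contains_ball by blast
    obtain j where "(1 / 2) ^ j < e / r" using real_arch_pow_inv[of "e / r" "1/2"] e r by auto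
    then have je: "r / 2 ^ j < e" using r by (simp add: power_divide field_simps)
    define p where "p = r / 2 ^ j"
    have p: "p > 0" "p < e" using r je by (auto simp: p_def)
    \<comment> \<open>At a radius this small the density is the full \<open>w\<close>, which exceeds
      \<epsilon>.\<close>
    have "ball x p \<inter> \<Omega> = ball x p" using e p by force
    then have "m x p = w * p ^ ?n" unfolding m_def w_def using p by (simp add: content_ball)
    then have "w * p ^ ?n \<le> \<epsilon> * p ^ ?n" using iter[of j] unfolding p_def[symmetric] by simp
    then have "w \<le> \<epsilon>" using p by simp
    then show False using \<epsilon>\<mu> \<mu> by linarith
  qed
  moreover have "\<epsilon> < 1" using \<epsilon>\<mu> \<mu> by linarith
  ultimately show ?thesis unfolding globally_regular_def m_def using \<epsilon>0 by blast
qed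

theorem theorem1p2:
  fixes phi :: "real \<Rightarrow> real" and \<alpha> :: real and \<Omega> :: "'a::euclidean_space set"
  assumes "DIM('a) \<ge> 2"
    and "- real DIM('a) < \<alpha>" and "\<alpha> < 0"
    and "young_function phi"
    and "lower_Lambda DIM('a) phi \<alpha> < \<infinity>"
    and "upper_Lambda DIM('a) phi \<alpha> < \<infinity>"
    and "is_domain \<Omega>"
  shows "globally_regular \<Omega> \<longleftrightarrow>
    (\<exists>C\<ge>1.
       (bounded \<Omega> \<longrightarrow>
          (\<forall>u\<in>besov_space \<alpha> phi \<Omega>.
             Lp_norm (real DIM('a) / \<bar>\<alpha>\<bar>) \<Omega> (\<lambda>x. u x - average \<Omega> u)
               \<le> ennreal (C * besov_norm \<alpha> phi \<Omega> u))) \<and>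
       (\<not> bounded \<Omega> \<longrightarrow>
          (\<forall>u\<in>besov_space \<alpha> phi \<Omega>. bounded {x\<in>\<Omega>. u x \<noteq> 0} \<longrightarrow>
             Lp_norm (real DIM('a) / \<bar>\<alpha>\<bar>) \<Omega> u
               \<le> ennreal (C * besov_norm \<alpha> phi \<Omega> u))))"
    (is "_ \<longleftrightarrow> (\<exists>C\<ge>1. ?E C)")
proof
  assume reg: "globally_regular \<Omega>"
  show "\<exists>C\<ge>1. ?E C"
  proof (cases "bounded \<Omega>")
    case True
    show ?thesis
      by (rule regular_imp_embedding_bounded[OF assms(4,2,3,6,7) reg True]) (use True in blast)
  next
    case False
    show ?thesis
      by (rule regular_imp_embedding_unbounded[OF assms(4,3,6,7) reg False]) (use False in blast)
  qed
next
  assume "\<exists>C\<ge>1. ?E C"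
  then obtain C where C: "C \<ge> 1" and E: "?E C" by blast
  show "globally_regular \<Omega>"
    by (rule embedding_imp_regular[OF assms(4,3,5,6,7) C]) (use E in blast)+
qed

end
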